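(* For all $d\ge5$, $\operatorname{trop}(\mathcal{B}\Sigma_{2d}^* )\supsetneq\operatorname{trop}(\mathcal{B}\mathcal{P}_{2d}^* )$.
   Context: Let $\Lambda_{2d}^{\varepsilon}$ be the set of partitions of $2d$ all of whose parts are even. For a partition $\lambda$, $p_\lambda=\prod_i p_{\lambda_i}$ with $p_r=X_1^r+\cdots+X_n^r$. $\mathcal{B}\Sigma_{2d}$ (respectively $\mathcal{B}\mathcal{P}_{2d}$) is the set of $c\in\mathbb{R}^{\Lambda_{2d}^\varepsilon}$ such that for every $n\ge2d$ the form $\sum_\lambda c_\lambda p_\lambda(X_1,\dots,X_n)$ is a sum of squares of real polynomials (respectively is nonnegative on $\mathbb{R}^n$). For a cone $K\subset\mathbb{R}^{\Lambda_{2d}^\varepsilon}$, the dual cone is $K^*=\{\varphi\in\mathbb{R}^{\Lambda_{2d}^\varepsilon}:\sum_\lambda c_\lambda\varphi_\lambda\ge0\ \text{for all } c\in K\}$ (coordinates with respect to the basis dual to $\{p_\lambda\}$); both dual cones here lie in the nonnegative orthant. For $S\subset\mathbb{R}_{\ge0}^s$, $\operatorname{trop}(S)=\lim_{t\to\infty}\log_t(S\cap\mathbb{R}_{>0}^s)$ with $\log_t$ applied coordinatewise; equivalently $y\in\operatorname{trop}(S)$ iff there are sequences $x^{(m)}\in S\cap\mathbb{R}_{>0}^s$ and $\tau_m\in(0,1)$ with $\tau_m\to0$ and $y=\lim_{m\to\infty}\log_{1/\tau_m}(x^{(m)})$. *)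

theory Defs
  imports "HOL-Analysis.Analysis" "HOL-Library.Multiset" "HOL-Library.FuncSet"
    "HOL-Library.Poly_Mapping"
begin

text \<open>A polynomial in the variables \<open>X 0, X 1, \<dots>\<close> is a finitely supported map from monomials
  (finitely supported exponent vectors) to coefficients; its product is the convolution product
  of \<open>HOL-Library.Poly_Mapping\<close>.\<close>

type_synonym mpoly = "(nat \<Rightarrow>\<^sub>0 nat) \<Rightarrow>\<^sub>0 real"

definition mvar :: "nat \<Rightarrow> mpoly"
  where "mvar i = Poly_Mapping.single (Poly_Mapping.single i 1) 1"

definition mconst :: "real \<Rightarrow> mpoly"
  where "mconst a = Poly_Mapping.single 0 a"

text \<open>The polynomial ring \<open>\<real>[X 1, \<dots>, X n]\<close>.\<close>

definition polys :: "nat \<Rightarrow> mpoly set"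
  where "polys n = {f. \<forall>m \<in> Poly_Mapping.keys f. Poly_Mapping.keys m \<subseteq> {1..n}}"

definition meval :: "(nat \<Rightarrow> real) \<Rightarrow> mpoly \<Rightarrow> real"
  where "meval x f =
    (\<Sum>m \<in> Poly_Mapping.keys f. Poly_Mapping.lookup f m *
       (\<Prod>i \<in> Poly_Mapping.keys m. x i ^ Poly_Mapping.lookup m i))"

definition is_sos :: "nat \<Rightarrow> mpoly \<Rightarrow> bool"
  where "is_sos n f \<longleftrightarrow> (\<exists>qs. set qs \<subseteq> polys n \<and> f = (\<Sum>q\<leftarrow>qs. q ^ 2))"

definition is_nonneg :: "nat \<Rightarrow> mpoly \<Rightarrow> bool"
  where "is_nonneg n f \<longleftrightarrow> (\<forall>x \<in> {1..n} \<rightarrow>\<^sub>E (UNIV :: real set). meval x f \<ge> 0)"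

text \<open>Partitions are multisets of positive integers.\<close>

definition even_partitions :: "nat \<Rightarrow> nat multiset set"
  where "even_partitions k = {l. (\<forall>r \<in># l. 0 < r \<and> even r) \<and> sum_mset l = k}"

definition power_sum :: "nat \<Rightarrow> nat \<Rightarrow> mpoly"
  where "power_sum n r = (\<Sum>i = 1..n. mvar i ^ r)"

definition power_sum_part :: "nat \<Rightarrow> nat multiset \<Rightarrow> mpoly"
  where "power_sum_part n l = (\<Prod>r \<in># l. power_sum n r)"

definition ps_form :: "nat \<Rightarrow> nat \<Rightarrow> (nat multiset \<Rightarrow> real) \<Rightarrow> mpoly"
  where "ps_form k n c = (\<Sum>l \<in> even_partitions k. mconst (c l) * power_sum_part n l)"

text \<open>For a finite set \<open>I\<close>, the space \<open>\<real>\<^sup>I\<close> is rendered as \<open>I \<rightarrow>\<^sub>E UNIV\<close>, so that vectors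
  are equal iff their coordinates in \<open>I\<close> are.\<close>

definition BSigma :: "nat \<Rightarrow> (nat multiset \<Rightarrow> real) set"
  where "BSigma k = {c \<in> even_partitions k \<rightarrow>\<^sub>E UNIV. \<forall>n\<ge>k. is_sos n (ps_form k n c)}"

definition BP :: "nat \<Rightarrow> (nat multiset \<Rightarrow> real) set"
  where "BP k = {c \<in> even_partitions k \<rightarrow>\<^sub>E UNIV. \<forall>n\<ge>k. is_nonneg n (ps_form k n c)}"

definition dual_cone :: "'i set \<Rightarrow> ('i \<Rightarrow> real) set \<Rightarrow> ('i \<Rightarrow> real) set"
  where "dual_cone I K = {\<phi> \<in> I \<rightarrow>\<^sub>E UNIV. \<forall>c \<in> K. (\<Sum>i \<in> I. c i * \<phi> i) \<ge> 0}"

text \<open>The logarithmic limit set of \<open>S \<inter> \<real>\<^sub>>\<^sub>0\<^sup>I\<close>: the limit, as \<open>t \<rightarrow> \<infinity>\<close>, of the images under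
  \<open>log t\<close>, spelled out by sequences with \<open>t = 1 / \<tau> m\<close>.\<close>

definition trop :: "'i set \<Rightarrow> ('i \<Rightarrow> real) set \<Rightarrow> ('i \<Rightarrow> real) set"
  where "trop I S = {y \<in> I \<rightarrow>\<^sub>E UNIV. \<exists>(x :: nat \<Rightarrow> 'i \<Rightarrow> real) (\<tau> :: nat \<Rightarrow> real).
    (\<forall>m. x m \<in> S \<and> (\<forall>i \<in> I. 0 < x m i)) \<and>
    (\<forall>m. 0 < \<tau> m \<and> \<tau> m < 1) \<and> \<tau> \<longlonglongrightarrow> 0 \<and>
    (\<forall>i \<in> I. (\<lambda>m. log (1 / \<tau> m) (x m i)) \<longlonglongrightarrow> y i)}"

text \<open>The index set is finite, so the sums over it are genuine.\<close>

lemma finite_even_partitions: "finite (even_partitions k)"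
proof -
  have "even_partitions k \<subseteq> mset ` {xs. set xs \<subseteq> {..k} \<and> length xs \<le> k}"
  proof
    fix l assume "l \<in> even_partitions k"
    then have pos: "\<And>r. r \<in># l \<Longrightarrow> 0 < r" and s: "sum_mset l = k"
      by (auto simp: even_partitions_def)
    obtain xs where xs: "mset xs = l"
      using ex_mset by blast
    have sl: "sum_list xs = k"
      using s xs sum_mset_sum_list by metis
    have "set xs \<subseteq> {..k}"
      using sl member_le_sum_list[of _ xs] by auto
    moreover have "length ys \<le> sum_list ys" if "\<forall>y \<in> set ys. 0 < y" for ys :: "nat list"
      using that by (induction ys) auto
    then have "length xs \<le> k"
      using pos xs sl by (metis set_mset_mset)
    ultimately show "l \<in> mset ` {xs. set xs \<subseteq> {..k} \<and> length xs \<le> k}"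
      using xs by blast
  qed
  then show ?thesis
    using finite_lists_length_le finite_subset by blast
qed

end

theory Submission
  imports Defs
begin

text \<open>The inclusion is monotonicity, as sums of squares are nonnegative. For strictness write
  \<open>y i = (x i)\<^sup>2\<close> and normalise \<open>p 1 = 1\<close>. On nonnegative points \<open>p 3\<^sup>2 \<le> p 2 ^ 3\<close>, hence
  \<open>p 3 ^ 5 \<le> (p 3 * p 2) ^ 3\<close>, and by weighted AM-GM the tropical inequality
  \<open>5 Y(3,1,\<dots>,1) \<le> 2 Y(1,\<dots>,1) + 3 Y(3,2,1,\<dots>,1)\<close> holds on the smaller set.

  It is violated by a functional with a negative point mass. Take a large \<open>b\<close>, put \<open>n = b ^ 10\<close> and
  let the vacuum be the point with all \<open>y i = 1 / n\<close>. Put mass \<open>b ^ 25\<close> on the vacuum perturbed by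
  \<open>b ^ -5\<close> at one coordinate and remove the mass \<open>b ^ 25 - b ^ 24\<close> from the vacuum itself. This lowers the
  moment of \<open>p 1 ^ d\<close> from \<open>b ^ 25\<close> to \<open>b ^ 24\<close>, while the moments of \<open>p 3\<close> and \<open>p 3 * p 2\<close> keep their
  orders \<open>b ^ 10\<close> and \<open>1\<close>. Positivity on squares is restored by further genuine masses which do not change
  these orders: \<open>b ^ 24\<close> on points spread over \<open>b ^ 8\<close> coordinates, and \<open>1\<close> on points with one
  coordinate of constant size. Indeed, averaging a square over sign changes and permutations reduces
  positivity to univariate polynomials of degree at most \<open>d\<close> along lines through the vacuum; their
  linear coefficient vanishes, the quadratic one is controlled by the first kind of additional
  points, and the higher ones by the second kind.\<close>

subsection \<open>Evaluation of polynomials\<close>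

definition mon_eval :: "(nat \<Rightarrow> real) \<Rightarrow> (nat \<Rightarrow>\<^sub>0 nat) \<Rightarrow> real"
  where "mon_eval x m = (\<Prod>i \<in> Poly_Mapping.keys m. x i ^ Poly_Mapping.lookup m i)"

lemma mon_eval_superset:
  assumes "finite A" "Poly_Mapping.keys m \<subseteq> A"
  shows "mon_eval x m = (\<Prod>i \<in> A. x i ^ Poly_Mapping.lookup m i)"
  unfolding mon_eval_def using assms by (intro prod.mono_neutral_left) (auto simp: in_keys_iff)

lemma mon_eval_0 [simp]: "mon_eval x 0 = 1"
  by (simp add: mon_eval_def)

lemma mon_eval_add: "mon_eval x (m + m') = mon_eval x m * mon_eval x m'"
proof -
  let ?A = "Poly_Mapping.keys m \<union> Poly_Mapping.keys m'"
  have "Poly_Mapping.keys (m + m') \<subseteq> ?A"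
    by (rule Poly_Mapping.keys_add)
  then show ?thesis
    by (simp add: mon_eval_superset[of ?A] lookup_add power_add prod.distrib)
qed

lemma meval_superset:
  assumes "finite A" "Poly_Mapping.keys f \<subseteq> A"
  shows "meval x f = (\<Sum>m \<in> A. Poly_Mapping.lookup f m * mon_eval x m)"
  unfolding meval_def mon_eval_def using assms
  by (intro sum.mono_neutral_left) (auto simp: in_keys_iff)

lemma meval_0 [simp]: "meval x 0 = 0"
  by (simp add: meval_def)

lemma meval_add: "meval x (f + g) = meval x f + meval x g"
proof -
  let ?A = "Poly_Mapping.keys f \<union> Poly_Mapping.keys g"
  have "Poly_Mapping.keys (f + g) \<subseteq> ?A"
    by (rule Poly_Mapping.keys_add)
  then show ?thesis
    by (simp add: meval_superset[of ?A] lookup_add algebra_simps sum.distrib)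
qed

lemma meval_sum: "meval x (\<Sum>i \<in> A. f i) = (\<Sum>i \<in> A. meval x (f i))"
  by (induction A rule: infinite_finite_induct) (simp_all add: meval_add)

lemma meval_single: "meval x (Poly_Mapping.single m a) = a * mon_eval x m"
  by (subst meval_superset[of "{m}"]) auto

lemma mpoly_sum_singles:
  "f = (\<Sum>m \<in> Poly_Mapping.keys f. Poly_Mapping.single m (Poly_Mapping.lookup f m))"
  by (rule poly_mapping_eqI)
    (simp add: lookup_sum lookup_single when_def in_keys_iff)

lemma meval_mult: "meval x (f * g) = meval x f * meval x g"
proof -
  let ?s = "\<lambda>f m. Poly_Mapping.single m (Poly_Mapping.lookup f m) :: mpoly"
  have "f * g = (\<Sum>m \<in> Poly_Mapping.keys f. ?s f m) * (\<Sum>m \<in> Poly_Mapping.keys g. ?s g m)"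
    using mpoly_sum_singles[of f] mpoly_sum_singles[of g] by simp
  then have "meval x (f * g) = (\<Sum>m \<in> Poly_Mapping.keys f. \<Sum>m' \<in> Poly_Mapping.keys g.
      Poly_Mapping.lookup f m * Poly_Mapping.lookup g m' * mon_eval x (m + m'))"
    by (simp add: sum_product meval_sum mult_single meval_single)
  also have "\<dots> = meval x f * meval x g"
    by (subst (1 2) meval_superset[OF _ order_refl])
      (simp_all add: sum_product mon_eval_add mult_ac)
  finally show ?thesis .
qed

lemma meval_1 [simp]: "meval x 1 = 1"
  using meval_single[of x 0 1] by simp

lemma meval_power: "meval x (f ^ k) = meval x f ^ k"
  by (induction k) (simp_all add: meval_mult)

lemma meval_sum_list: "meval x (sum_list fs) = (\<Sum>f\<leftarrow>fs. meval x f)"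
  by (induction fs) (simp_all add: meval_add)

lemma meval_mvar [simp]: "meval x (mvar i) = x i"
  by (simp add: mvar_def meval_single mon_eval_def)

lemma meval_mconst [simp]: "meval x (mconst a) = a"
  by (simp add: mconst_def meval_single)

lemma meval_power_sum: "meval x (power_sum n r) = (\<Sum>i = 1..n. x i ^ r)"
  by (simp add: power_sum_def meval_sum meval_power)

lemma meval_power_sum_part:
  "meval x (power_sum_part n l) = (\<Prod>r \<in># l. \<Sum>i = 1..n. x i ^ r)"
  unfolding power_sum_part_def by (induction l) (simp_all add: meval_mult meval_power_sum)

lemma meval_ps_form:
  "meval x (ps_form k n c) = (\<Sum>l \<in> even_partitions k. c l * (\<Prod>r \<in># l. \<Sum>i = 1..n. x i ^ r))"
  by (simp add: ps_form_def meval_sum meval_mult meval_power_sum_part)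

section \<open>Monotonicity, which gives the inclusion of the tropicalizations\<close>

lemma is_sos_imp_is_nonneg: "is_sos n f \<Longrightarrow> is_nonneg n f"
  by (auto simp: is_sos_def is_nonneg_def meval_sum_list meval_power o_def intro!: sum_list_nonneg)

lemma BSigma_subset_BP: "BSigma k \<subseteq> BP k"
  by (auto simp: BSigma_def BP_def is_sos_imp_is_nonneg)

lemma dual_cone_antimono: "K \<subseteq> K' \<Longrightarrow> dual_cone I K' \<subseteq> dual_cone I K"
  by (auto simp: dual_cone_def)

lemma trop_mono: "S \<subseteq> S' \<Longrightarrow> trop I S \<subseteq> trop I S'"
  unfolding trop_def by (intro Collect_mono) blast

text \<open>The points of \<open>\<real>\<^sup>n\<close> enter through \<open>y i = (x i)\<^sup>2\<close>, so a power sum of index \<open>r\<close> in \<open>x\<close> is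
  one of index \<open>r div 2\<close> in \<open>y\<close>.\<close>

definition psum :: "nat \<Rightarrow> (nat \<Rightarrow> real) \<Rightarrow> nat \<Rightarrow> real"
  where "psum n y k = (\<Sum>i = 1..n. y i ^ k)"

definition psum_part :: "nat \<Rightarrow> (nat \<Rightarrow> real) \<Rightarrow> nat multiset \<Rightarrow> real"
  where "psum_part n y l = (\<Prod>r \<in># l. psum n y (r div 2))"

lemma even_power_eq: "even r \<Longrightarrow> x ^ r = (x\<^sup>2) ^ (r div 2)" for x :: real
  by (simp flip: power_mult)

lemma meval_ps_form_eq_psum_part:
  "meval x (ps_form k n c) = (\<Sum>l \<in> even_partitions k. c l * psum_part n (\<lambda>i. (x i)\<^sup>2) l)"
  unfolding meval_ps_form psum_part_def psum_def
  by (intro sum.cong refl arg_cong[where f = "\<lambda>t. _ * t"] arg_cong[where f = prod_mset]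
      image_mset_cong even_power_eq) (auto simp: even_partitions_def)

lemma psum_scale: "psum n (\<lambda>i. s * y i) k = s ^ k * psum n y k"
  by (simp add: psum_def power_mult_distrib sum_distrib_left)

text \<open>Halving the parts turns a partition of \<open>2 * d\<close> into one of
  \<open>d\<close>, the degree in the squared coordinates.\<close>

lemma psum_part_homogeneous:
  assumes "l \<in> even_partitions (2 * d)"
  shows "psum_part n (\<lambda>i. s * y i) l = s ^ d * psum_part n y l"
proof -
  have ev: "\<forall>r \<in># l. even r" and sm: "sum_mset l = 2 * d"
    using assms by (auto simp: even_partitions_def)
  have "psum_part n (\<lambda>i. s * y i) l = s ^ (\<Sum>r \<in># l. r div 2) * psum_part n y l"
    unfolding psum_part_def psum_scale by (induction l) (simp_all add: power_add mult_ac)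
  moreover have "2 * (\<Sum>r \<in># l. r div 2) = sum_mset l"
    using ev by (induction l) auto
  ultimately show ?thesis using sm by simp
qed

lemma psum_permute:
  assumes "p permutes {1..n}"
  shows "psum n (\<lambda>i. y (p i)) k = psum n y k"
  unfolding psum_def by (rule sum.permute[OF assms, symmetric, unfolded o_def])

lemma psum_part_permute:
  assumes "p permutes {1..n}"
  shows "psum_part n (\<lambda>i. y (p i)) l = psum_part n y l"
  by (simp add: psum_part_def psum_permute[OF assms])

section \<open>Averages over sign changes\<close>

lemma sum_signs_prod:
  assumes "finite I"
  shows "(\<Sum>\<epsilon> \<in> I \<rightarrow>\<^sub>E {1, -1}. \<Prod>i \<in> I. (\<epsilon> i :: real) ^ k i) =
    (if \<forall>i \<in> I. even (k i) then 2 ^ card I else 0)"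
proof -
  have "(\<Sum>\<epsilon> \<in> I \<rightarrow>\<^sub>E {1, -1}. \<Prod>i \<in> I. (\<epsilon> i :: real) ^ k i) = (\<Prod>i \<in> I. \<Sum>e \<in> {1, -1}. e ^ k i)"
    using assms by (subst prod_sum_PiE) auto
  also have "\<dots> = (\<Prod>i \<in> I. if even (k i) then 2 else 0)"
    by (intro prod.cong) auto
  also have "\<dots> = (if \<forall>i \<in> I. even (k i) then 2 ^ card I else 0)"
    using assms by (auto simp: prod_zero_iff)
  finally show ?thesis .
qed

text \<open>Monomials with different sets of odd exponents belong to distinct characters of the sign
  group, so their cross terms cancel in the average. Each parity class then contributes its own
  square.\<close>

lemma sum_signs_square:
  fixes c :: "'a \<Rightarrow> real" and e :: "'a \<Rightarrow> 'i \<Rightarrow> nat"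
  assumes I: "finite I" and A: "finite A"
  shows "(\<Sum>\<epsilon> \<in> I \<rightarrow>\<^sub>E {1, -1}. (\<Sum>a \<in> A. c a * (\<Prod>i \<in> I. (\<epsilon> i * x i) ^ e a i))\<^sup>2) =
    2 ^ card I * (\<Sum>S \<in> Pow I. (\<Sum>a \<in> {a \<in> A. {i \<in> I. odd (e a i)} = S}. c a * (\<Prod>i \<in> I. x i ^ e a i))\<^sup>2)"
    (is "?L = _ * ?R")
proof -
  define od where "od a = {i \<in> I. odd (e a i)}" for a
  define v where "v a = c a * (\<Prod>i \<in> I. x i ^ e a i)" for a
  have par: "(\<forall>i \<in> I. even (e a i + e b i)) \<longleftrightarrow> od a = od b" for a b
    unfolding od_def by auto
  \<comment> \<open>Writing equality of parities as a sum over the common parity set lets the double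
    sum split into one square per set.\<close>
  have delta: "(\<Sum>S \<in> Pow I. if od a = S \<and> od b = S then z else 0) = (if od a = od b then z else 0)"
    for a b and z :: real
  proof -
    have "(\<Sum>S \<in> Pow I. if od a = S \<and> od b = S then z else 0) =
        (\<Sum>S \<in> Pow I. if S = od a then (if od a = od b then z else 0) else 0)"
      by (intro sum.cong) auto
    also have "\<dots> = (if od a = od b then z else 0)"
      using I by (subst sum.delta) (auto simp: od_def)
    finally show ?thesis .
  qed
  have "?L = (\<Sum>\<epsilon> \<in> I \<rightarrow>\<^sub>E {1, -1}. \<Sum>a \<in> A. \<Sum>b \<in> A. v a * v b * (\<Prod>i \<in> I. \<epsilon> i ^ (e a i + e b i)))"
    unfolding power2_eq_square sum_product v_def
    by (simp add: power_mult_distrib power_add prod.distrib mult_ac)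
  also have "\<dots> = (\<Sum>a \<in> A. \<Sum>b \<in> A. v a * v b *
      (\<Sum>\<epsilon> \<in> I \<rightarrow>\<^sub>E {1, -1}. \<Prod>i \<in> I. \<epsilon> i ^ (e a i + e b i)))"
    by (subst sum.swap, intro sum.cong refl, subst sum.swap)
      (simp add: sum_distrib_left)
  also have "\<dots> = (\<Sum>a \<in> A. \<Sum>b \<in> A. if od a = od b then 2 ^ card I * (v a * v b) else 0)"
    unfolding sum_signs_prod[OF I] par by (intro sum.cong) auto
  also have "\<dots> = (\<Sum>a \<in> A. \<Sum>b \<in> A. \<Sum>S \<in> Pow I.
      if od a = S \<and> od b = S then 2 ^ card I * (v a * v b) else 0)"
    by (simp only: delta)
  also have "\<dots> = (\<Sum>a \<in> A. \<Sum>S \<in> Pow I. \<Sum>b \<in> A.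
      if od a = S \<and> od b = S then 2 ^ card I * (v a * v b) else 0)"
    by (intro sum.cong refl sum.swap)
  also have "\<dots> = (\<Sum>S \<in> Pow I. \<Sum>a \<in> A. \<Sum>b \<in> A.
      if od a = S \<and> od b = S then 2 ^ card I * (v a * v b) else 0)"
    by (rule sum.swap)
  also have "\<dots> = 2 ^ card I * (\<Sum>S \<in> Pow I. (\<Sum>a \<in> {a \<in> A. od a = S}. v a)\<^sup>2)"
    unfolding sum_distrib_left
  proof (intro sum.cong refl)
    fix S
    have "(\<Sum>a \<in> A. \<Sum>b \<in> A. if od a = S \<and> od b = S then 2 ^ card I * (v a * v b) else 0) =
      (\<Sum>a \<in> A. if od a = S then (\<Sum>b \<in> A. if od b = S then 2 ^ card I * (v a * v b) else 0) else 0)"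
      by (intro sum.cong) auto
    also have "\<dots> = (\<Sum>a \<in> {a \<in> A. od a = S}. \<Sum>b \<in> {b \<in> A. od b = S}. 2 ^ card I * (v a * v b))"
      unfolding sum.inter_filter[OF A] ..
    also have "\<dots> = 2 ^ card I * (\<Sum>a \<in> {a \<in> A. od a = S}. v a)\<^sup>2"
      by (simp only: power2_eq_square sum_product) (simp only: sum_distrib_left)
    finally show "(\<Sum>a \<in> A. \<Sum>b \<in> A. if od a = S \<and> od b = S then 2 ^ card I * (v a * v b) else 0)
      = 2 ^ card I * (\<Sum>a \<in> {a \<in> A. od a = S}. v a)\<^sup>2" .
  qed
  finally show ?thesis unfolding od_def v_def .
qed

subsection \<open>Coefficients and values of univariate polynomials\<close>

text \<open>Lagrange interpolation writes each coefficient as a fixed linear form in the values at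
  the nodes, and Cauchy-Schwarz bounds this form. The constant depends only on the nodes and
  \<open>d\<close>.\<close>

lemma coeff_le_values:
  fixes u :: "nat \<Rightarrow> real"
  assumes u: "inj_on u {..d}"
  shows "\<exists>C>0. \<forall>p k. degree p \<le> d \<longrightarrow> (coeff p k)\<^sup>2 \<le> C * (\<Sum>j\<le>d. (poly p (u j))\<^sup>2)"
proof -
  define L where "L j = (\<Prod>i \<in> {..d} - {j}. smult (1 / (u j - u i)) [:- u i, 1:])" for j
  have degL: "degree (L j) \<le> d" if "j \<le> d" for j
  proof -
    have "degree (L j) \<le> (\<Sum>i \<in> {..d} - {j}. degree (smult (1 / (u j - u i)) [:- u i, 1:]))"
      unfolding L_def
      using degree_prod_sum_le[of "{..d} - {j}" "\<lambda>i. smult (1 / (u j - u i)) [:- u i, 1:]"]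
      by (simp only: o_def finite_Diff finite_atMost simp_thms)
    also have "\<dots> \<le> (\<Sum>i \<in> {..d} - {j}. 1)"
      by (intro sum_mono order.trans[OF degree_smult_le]) auto
    finally show ?thesis using that by simp
  qed
  have polyL: "poly (L j) (u i) = (if i = j then 1 else 0)" if "i \<le> d" "j \<le> d" for i j
  proof (cases "i = j")
    case True
    have "u j - u k \<noteq> 0" if "k \<in> {..d} - {j}" for k
      using u that \<open>j \<le> d\<close> by (auto simp: inj_on_def)
    then show ?thesis
      unfolding L_def poly_prod True by (simp only: simp_thms if_True) (intro prod.neutral ballI, simp add: divide_simps)
  next
    case False
    then show ?thesis
      unfolding L_def poly_prod using that by (auto intro!: prod_zero)
  qed
  \<comment> \<open>Summing over all \<open>k\<close> serves every coefficient at once; the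
    \<open>1\<close> makes positivity immediate.\<close>
  define C where "C = 1 + (\<Sum>k\<le>d. \<Sum>j\<le>d. (coeff (L j) k)\<^sup>2)"
  have C: "C \<ge> 1" unfolding C_def by (simp add: sum_nonneg)
  have "(coeff p k)\<^sup>2 \<le> C * (\<Sum>j\<le>d. (poly p (u j))\<^sup>2)" if p: "degree p \<le> d" for p k
  proof (cases "k \<le> d")
    case True
    have "p = (\<Sum>j\<le>d. smult (poly p (u j)) (L j))"
    proof (rule poly_eqI_degree[where A = "u ` {..d}"])
      fix x assume "x \<in> u ` {..d}"
      then obtain i where i: "i \<le> d" "x = u i" by auto
      have "poly (\<Sum>j\<le>d. smult (poly p (u j)) (L j)) x = (\<Sum>j\<le>d. poly p (u j) * poly (L j) (u i))"
        by (simp add: poly_sum i)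
      also have "\<dots> = (\<Sum>j\<le>d. if j = i then poly p (u i) else 0)"
        using i polyL by (intro sum.cong) auto
      also have "\<dots> = poly p x" using i by simp
      finally show "poly p x = poly (\<Sum>j\<le>d. smult (poly p (u j)) (L j)) x" ..
    next
      have "degree (\<Sum>j\<le>d. smult (poly p (u j)) (L j)) \<le> d"
        using degL by (intro degree_sum_le) (auto intro: order.trans[OF degree_smult_le])
      then show "degree (\<Sum>j\<le>d. smult (poly p (u j)) (L j)) < card (u ` {..d})"
        using u by (simp add: card_image)
    qed (use p u in \<open>simp add: card_image\<close>)
    then have "coeff p k = (\<Sum>j\<le>d. coeff (L j) k * poly p (u j))"
      by (metis (no_types, lifting) coeff_smult coeff_sum mult.commute sum.cong)
    then have "(coeff p k)\<^sup>2 \<le> (\<Sum>j\<le>d. (coeff (L j) k)\<^sup>2) * (\<Sum>j\<le>d. (poly p (u j))\<^sup>2)"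
      using Cauchy_Schwarz_ineq_sum by simp
    also have "\<dots> \<le> C * (\<Sum>j\<le>d. (poly p (u j))\<^sup>2)"
    proof (intro mult_right_mono sum_nonneg)
      have "(\<Sum>j\<le>d. (coeff (L j) k)\<^sup>2) \<le> (\<Sum>k\<le>d. \<Sum>j\<le>d. (coeff (L j) k)\<^sup>2)"
        by (rule member_le_sum[of k "{..d}" "\<lambda>k. \<Sum>j\<le>d. (coeff (L j) k)\<^sup>2"])
          (use True in \<open>auto intro: sum_nonneg\<close>)
      then show "(\<Sum>j\<le>d. (coeff (L j) k)\<^sup>2) \<le> C" by (simp add: C_def)
    qed auto
    finally show ?thesis .
  next
    case False
    then have "coeff p k = 0" using p by (intro coeff_eq_0) simp
    then show ?thesis using C by (simp add: sum_nonneg)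
  qed
  then show ?thesis using C by (intro exI[of _ C]) auto
qed

text \<open>Replacing \<open>x\<close> by \<open>s * x\<close> multiplies the coefficient by
  \<open>s ^ k\<close>, whereas the values at fixed nodes grow at most like \<open>s ^ d\<close>.
  For large \<open>s\<close> this is impossible unless the coefficient vanishes.\<close>

lemma coeff_eq_0_of_growth:
  fixes r :: "real poly"
  assumes growth: "\<And>x. x > 0 \<Longrightarrow> (poly r x)\<^sup>2 \<le> B * x ^ (2 * d)" and k: "k > d"
  shows "coeff r k = 0"
proof (rule ccontr)
  assume c: "coeff r k \<noteq> 0"
  \<comment> \<open>The nodes are shifted to be positive, since growth is controlled only
    there.\<close>
  have "inj_on (\<lambda>j::nat. real j + 1) {..degree r}"
    by (auto simp: inj_on_def)
  then obtain C where C: "C > 0" "\<And>p k. degree p \<le> degree r \<Longrightarrow>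
      (coeff p k)\<^sup>2 \<le> C * (\<Sum>j\<le>degree r. (poly p (real j + 1))\<^sup>2)"
    using coeff_le_values by blast
  define D where "D = C * (\<Sum>j\<le>degree r. B * (real j + 1) ^ (2 * d))"
  have B: "B \<ge> 0" using order.trans[OF zero_le_power2 growth[of 1]] by simp
  then have D: "D \<ge> 0" unfolding D_def using C by (intro mult_nonneg_nonneg sum_nonneg) auto
  have bd: "(coeff r k)\<^sup>2 * s \<le> D" if s: "s \<ge> 1" for s :: real
  proof -
    let ?p = "pcompose r (monom s (Suc 0))"
    have "degree ?p \<le> degree r"
      using degree_pcompose_le[of r "monom s (Suc 0)"]
      by (rule order.trans) (use degree_monom_le[of s "Suc 0"] in auto)
    then have "(coeff ?p k)\<^sup>2 \<le> C * (\<Sum>j\<le>degree r. (poly ?p (real j + 1))\<^sup>2)"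
      by (rule C)
    also have "\<dots> \<le> C * (\<Sum>j\<le>degree r. B * (s * (real j + 1)) ^ (2 * d))"
      using C s by (intro mult_left_mono sum_mono)
        (auto simp: poly_pcompose poly_monom intro!: growth)
    also have "\<dots> = s ^ (2 * d) * D"
      by (simp add: D_def power_mult_distrib sum_distrib_left mult_ac)
    finally have *: "(coeff ?p k)\<^sup>2 \<le> s ^ (2 * d) * D" .
    have "s ^ (2 * d) * (s ^ (2 * (k - d)) * (coeff r k)\<^sup>2) \<le> s ^ (2 * d) * D"
    proof -
      have "s ^ (2 * d) * s ^ (2 * (k - d)) = (s ^ k)\<^sup>2"
      proof -
        have "2 * d + 2 * (k - d) = k * 2" using k by simp
        then show ?thesis by (metis power_add power_mult)
      qed
      then show ?thesis
        using * by (simp add: power_mult_distrib mult.assoc[symmetric])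
    qed
    then have "s ^ (2 * (k - d)) * (coeff r k)\<^sup>2 \<le> D"
      using s by (simp add: mult_le_cancel_left)
    moreover have "s ^ 1 \<le> s ^ (2 * (k - d))"
      using s k by (intro power_increasing) auto
    ultimately show ?thesis
      by (smt (verit, best) mult.commute mult_right_mono power_one_right zero_le_power2)
  qed
  \<comment> \<open>For this choice of \<open>s\<close> the left side equals
    \<open>(coeff r k)\<^sup>2 + D\<close>, which exceeds \<open>D\<close>.\<close>
  have "(coeff r k)\<^sup>2 * (1 + D / (coeff r k)\<^sup>2) \<le> D"
    by (rule bd) (use D in auto)
  then show False using c by (simp add: distrib_left)
qed

subsection \<open>Averages over permutations\<close>

definition perm_avg :: "nat \<Rightarrow> ((nat \<Rightarrow> real) \<Rightarrow> real) \<Rightarrow> (nat \<Rightarrow> real) \<Rightarrow> real"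
  where "perm_avg n h y = (\<Sum>p | p permutes {1..n}. h (\<lambda>i. y (p i))) / fact n"

lemma card_perms: "card {p. p permutes {Suc 0..n}} = fact n"
  by (rule card_permutations) auto

lemma perm_avg_mono:
  assumes "\<And>p. p permutes {1..n} \<Longrightarrow> h (\<lambda>i. y (p i)) \<le> h' (\<lambda>i. y (p i))"
  shows "perm_avg n h y \<le> perm_avg n h' y"
  unfolding perm_avg_def using assms by (intro divide_right_mono sum_mono) auto

lemma perm_avg_cong:
  assumes "\<And>p. p permutes {1..n} \<Longrightarrow> h (\<lambda>i. y (p i)) = h' (\<lambda>i. y (p i))"
  shows "perm_avg n h y = perm_avg n h' y"
  unfolding perm_avg_def using assms by (intro arg_cong2[where f = "(/)"] sum.cong) auto

lemma perm_avg_cmult: "perm_avg n (\<lambda>y. c * h y) y = c * perm_avg n h y"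
  by (simp add: perm_avg_def sum_distrib_left)

lemma perm_avg_sum: "perm_avg n (\<lambda>y. \<Sum>a \<in> A. h a y) y = (\<Sum>a \<in> A. perm_avg n (h a) y)"
  unfolding perm_avg_def by (subst sum.swap) (simp add: sum_divide_distrib)

lemma perm_avg_const: "perm_avg n h (\<lambda>i. c) = h (\<lambda>i. c)"
  by (simp add: perm_avg_def card_perms)

lemma perm_avg_invariant:
  assumes "\<And>p. p permutes {1..n} \<Longrightarrow> h (\<lambda>i. y (p i)) = h y"
  shows "perm_avg n h y = h y"
  using assms by (simp add: perm_avg_def card_perms)

lemma perm_avg_square_le: "(perm_avg n g y)\<^sup>2 \<le> perm_avg n (\<lambda>y. (g y)\<^sup>2) y"
  unfolding perm_avg_def
  using sum_squared_le_sum_of_squares[of "\<lambda>p. g (\<lambda>i. y (p i))" "{p. p permutes {1..n}}"]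
  by (simp add: card_perms power_divide divide_simps power2_eq_square)

text \<open>Every permuted point still has all coordinates at least \<open>m\<close>, so the weight
  is bounded below by a constant, and Cauchy-Schwarz bounds the average of the squares by the square
  of the average.\<close>

lemma perm_avg_weighted_square_ge:
  assumes S: "S \<subseteq> {1..n}" and m: "m \<ge> 0" and y: "\<And>i. i \<in> {1..n} \<Longrightarrow> m \<le> y i"
  shows "m ^ card S * (perm_avg n g y)\<^sup>2 \<le> perm_avg n (\<lambda>y. (\<Prod>i \<in> S. y i) * (g y)\<^sup>2) y"
proof -
  have "m ^ card S * (perm_avg n g y)\<^sup>2 \<le> perm_avg n (\<lambda>y. m ^ card S * (g y)\<^sup>2) y"
    unfolding perm_avg_cmult using m by (intro mult_left_mono perm_avg_square_le) auto
  also have "\<dots> \<le> perm_avg n (\<lambda>y. (\<Prod>i \<in> S. y i) * (g y)\<^sup>2) y"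
  proof (intro perm_avg_mono mult_right_mono)
    fix p assume p: "p permutes {1..n}"
    have "(\<Prod>i \<in> S. m) \<le> (\<Prod>i \<in> S. y (p i))"
      using m y S permutes_in_image[OF p] by (intro prod_mono) blast
    then show "m ^ card S \<le> (\<Prod>i \<in> S. y (p i))" by simp
  qed auto
  finally show ?thesis .
qed

lemma sum_perms_shift:
  assumes "q permutes {1..n}"
  shows "(\<Sum>p | p permutes {1..n}. f (p (q i)) (p (q j))) = (\<Sum>p | p permutes {1..n}. f (p i) (p j))"
  using sum_permutations_compose_right[OF assms, of "\<lambda>p. f (p i) (p j)"] by simp

text \<open>By symmetry the second moments take one value on the diagonal and one off it. The first
  comes from the sum of squares, and the vanishing sum of \<open>w\<close> then fixes the
  second.\<close>

lemma sum_perms_pair: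
  fixes w :: "nat \<Rightarrow> real"
  assumes n: "n \<ge> 2" and w: "(\<Sum>i = 1..n. w i) = 0" and i: "i \<in> {1..n}" and j: "j \<in> {1..n}"
  shows "(\<Sum>p | p permutes {1..n}. w (p i)) = 0"
    and "(\<Sum>p | p permutes {1..n}. w (p i) * w (p j)) =
      fact n * ((if i = j then 1 else - 1 / (real n - 1)) / real n) * (\<Sum>i = 1..n. (w i)\<^sup>2)"
proof -
  have tr: "Transposition.transpose a b permutes {1..n}" if "a \<in> {1..n}" "b \<in> {1..n}" for a b
    using that by (rule permutes_swap_id)
  have sw: "(\<Sum>a = 1..n. f (p a)) = (\<Sum>a = 1..n. f a)" if "p permutes {1..n}" for f :: "nat \<Rightarrow> real" and p
    using sum.permute[OF that, of f] by (simp add: o_def)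
  have same: "(\<Sum>p | p permutes {1..n}. f (p a)) * real n = fact n * (\<Sum>a = 1..n. f a)"
    if a: "a \<in> {1..n}" for a and f :: "nat \<Rightarrow> real"
  proof -
    have "(\<Sum>p | p permutes {1..n}. f (p b)) = (\<Sum>p | p permutes {1..n}. f (p a))"
      if "b \<in> {1..n}" for b
      using sum_perms_shift[OF tr[OF a that], of "\<lambda>x y. f x" a a] by simp
    then have "(\<Sum>b = 1..n. \<Sum>p | p permutes {1..n}. f (p b)) =
        real n * (\<Sum>p | p permutes {1..n}. f (p a))"
      by simp
    moreover have "(\<Sum>b = 1..n. \<Sum>p | p permutes {1..n}. f (p b)) =
        (\<Sum>p | p permutes {1..n}. \<Sum>a = 1..n. f a)"
      by (subst sum.swap) (intro sum.cong refl sw, simp)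
    then have "(\<Sum>b = 1..n. \<Sum>p | p permutes {1..n}. f (p b)) = fact n * (\<Sum>a = 1..n. f a)"
      by (simp add: card_perms)
    ultimately show ?thesis by (simp add: mult.commute)
  qed
  show "(\<Sum>p | p permutes {1..n}. w (p i)) = 0"
    using same[OF i, of w] w n by simp
  define Y where "Y a b = (\<Sum>p | p permutes {1..n}. w (p a) * w (p b))" for a b
  have diag: "Y i i * real n = fact n * (\<Sum>i = 1..n. (w i)\<^sup>2)"
    unfolding Y_def using same[OF i, of "\<lambda>a. w a * w a"] by (simp add: power2_eq_square)
  \<comment> \<open>Swapping \<open>j\<close> and \<open>b\<close> fixes \<open>i\<close>, so the
    off-diagonal entries of a row agree.\<close>
  have off: "Y i b = Y i j" if "b \<in> {1..n}" "b \<noteq> i" "i \<noteq> j" for b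
  proof -
    have "Transposition.transpose j b i = i"
      using that by (simp add: transpose_def)
    then show ?thesis
      using sum_perms_shift[OF tr[OF j that(1)], of "\<lambda>x y. w x * w y" i j]
      by (simp add: Y_def)
  qed
  have "Y i i + (real n - 1) * Y i j = 0" if "i \<noteq> j"
  proof -
    have "(\<Sum>b = 1..n. w (p i) * w (p b)) = 0" if "p permutes {1..n}" for p
      using sw[OF that, of w] w by (simp flip: sum_distrib_left)
    then have "(\<Sum>b = 1..n. Y i b) = 0"
      unfolding Y_def by (subst sum.swap) (intro sum.neutral, simp)
    moreover have "(\<Sum>b = 1..n. Y i b) = Y i i + (\<Sum>b \<in> {1..n} - {i}. Y i b)"
      using i by (intro sum.remove) auto
    moreover have "(\<Sum>b \<in> {1..n} - {i}. Y i b) = (\<Sum>b \<in> {1..n} - {i}. Y i j)"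
      using that by (intro sum.cong) (auto intro: off)
    moreover have "card ({1..n} - {i}) = n - 1"
      using i by simp
    ultimately show ?thesis using n by (simp add: of_nat_diff)
  qed
  then have "i \<noteq> j \<Longrightarrow> Y i j = - Y i i / (real n - 1)"
    using n by (simp add: field_simps)
  moreover have "Y i i = fact n * (\<Sum>i = 1..n. (w i)\<^sup>2) / real n"
    using diag n by (simp add: field_simps)
  ultimately show "(\<Sum>p | p permutes {1..n}. w (p i) * w (p j)) =
      fact n * ((if i = j then 1 else - 1 / (real n - 1)) / real n) * (\<Sum>i = 1..n. (w i)\<^sup>2)"
    unfolding Y_def[symmetric] by (cases "i = j") (simp_all add: mult_ac)
qed

text \<open>For a product of linear factors \<open>1 + w X\<close> the second component is the sum of the \<open>w\<close>
  and the third one the sum of the \<open>w\<^sup>2\<close> (Newton's identity).\<close>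

definition low_coeffs :: "real poly \<Rightarrow> real \<Rightarrow> real \<Rightarrow> bool"
  where "low_coeffs p a b \<longleftrightarrow> coeff p 0 = 1 \<and> coeff p 1 = a \<and> 2 * coeff p 2 = a\<^sup>2 - b"

lemma low_coeffs_1: "low_coeffs 1 0 0"
  by (simp add: low_coeffs_def)

lemma low_coeffs_linear: "low_coeffs [:1, w:] w (w\<^sup>2)"
  by (simp add: low_coeffs_def coeff_pCons numeral_2_eq_2)

text \<open>The product of the two linear coefficients accounts for the mixed term of
  \<open>(a + a')\<^sup>2\<close>, which is why the third components simply add.\<close>

lemma low_coeffs_mult:
  assumes "low_coeffs p a b" "low_coeffs q a' b'"
  shows "low_coeffs (p * q) (a + a') (b + b')"
proof -
  have "coeff (p * q) 2 = coeff p 0 * coeff q 2 + coeff p 1 * coeff q 1 + coeff p 2 * coeff q 0"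
    by (simp add: coeff_mult numeral_2_eq_2)
  moreover have "coeff (p * q) 1 = coeff p 0 * coeff q 1 + coeff p 1 * coeff q 0"
    by (simp add: coeff_mult)
  ultimately show ?thesis
    using assms by (auto simp: low_coeffs_def coeff_mult_0 power2_eq_square algebra_simps)
qed

lemma low_coeffs_power: "low_coeffs p a b \<Longrightarrow> low_coeffs (p ^ k) (real k * a) (real k * b)"
proof (induction k)
  case (Suc k)
  then show ?case
    using low_coeffs_mult[of p a b "p ^ k" "real k * a" "real k * b"]
    by (simp add: algebra_simps)
qed (simp add: low_coeffs_1)

lemma low_coeffs_prod:
  "finite I \<Longrightarrow> (\<And>i. i \<in> I \<Longrightarrow> low_coeffs (p i) (a i) (b i)) \<Longrightarrow>
    low_coeffs (\<Prod>i \<in> I. p i) (\<Sum>i \<in> I. a i) (\<Sum>i \<in> I. b i)"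
  by (induction I rule: finite_induct) (auto simp: low_coeffs_1 low_coeffs_mult)

text \<open>Averaging removes the first moment of \<open>w\<close> and turns its second moments into
  multiples of its sum of squares. The order of quantifiers matters: \<open>a0\<close> and
  \<open>c2\<close> do not depend on the direction \<open>w\<close>, so quadratic coefficients along
  different lines can be compared.\<close>

lemma perm_avg_line:
  fixes c :: "'a \<Rightarrow> real" and k :: "'a \<Rightarrow> nat \<Rightarrow> nat"
  assumes n: "n \<ge> 2" and A: "finite A" and deg: "\<And>a. a \<in> A \<Longrightarrow> (\<Sum>i = 1..n. k a i) \<le> d"
  defines "g \<equiv> \<lambda>y. \<Sum>a \<in> A. c a * (\<Prod>i = 1..n. y i ^ k a i)"
  shows "\<exists>a0 c2. \<forall>w. (\<Sum>i = 1..n. w i) = 0 \<longrightarrow>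
    (\<exists>P. degree P \<le> d \<and> (\<forall>\<rho>. poly P \<rho> = perm_avg n g (\<lambda>i. (1 + \<rho> * w i) / real n)) \<and>
      coeff P 0 = a0 \<and> coeff P 1 = 0 \<and> coeff P 2 = c2 * (\<Sum>i = 1..n. (w i)\<^sup>2))"
proof -
  \<comment> \<open>\<open>\<gamma>\<close> is the normalised second moment from
    \<open>sum_perms_pair\<close>, and \<open>c'\<close> absorbs the denominators
    \<open>real n\<close> of a monomial.\<close>
  define \<gamma> where "\<gamma> i j = (if i = j then 1 else - 1 / (real n - 1)) / real n" for i j :: nat
  define c' where "c' a = c a / real n ^ (\<Sum>i = 1..n. k a i)" for a
  define a0 where "a0 = (\<Sum>a \<in> A. c' a)"
  define c2 where "c2 = (\<Sum>a \<in> A. c' a * (((\<Sum>i = 1..n. \<Sum>j = 1..n. real (k a i) * real (k a j) * \<gamma> i j) -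
      (\<Sum>i = 1..n. real (k a i) * \<gamma> i i)) / 2))"
  have "\<exists>P. degree P \<le> d \<and> (\<forall>\<rho>. poly P \<rho> = perm_avg n g (\<lambda>i. (1 + \<rho> * w i) / real n)) \<and>
      coeff P 0 = a0 \<and> coeff P 1 = 0 \<and> coeff P 2 = c2 * (\<Sum>i = 1..n. (w i)\<^sup>2)"
    if w: "(\<Sum>i = 1..n. w i) = 0" for w
  proof -
    let ?\<Pi> = "{p. p permutes {1..n}}"
    define W where "W = (\<Sum>i = 1..n. (w i)\<^sup>2)"
    note pair = sum_perms_pair(2)[OF n w, folded W_def]
    define Q where "Q a p = (\<Prod>i = 1..n. [:1, w (p i):] ^ k a i)" for a and p :: "nat \<Rightarrow> nat"
    define P where "P = smult (1 / fact n) (\<Sum>p \<in> ?\<Pi>. \<Sum>a \<in> A. smult (c' a) (Q a p))"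
    have coeffP: "coeff P m = (\<Sum>a \<in> A. c' a * ((\<Sum>p \<in> ?\<Pi>. coeff (Q a p) m) / fact n))" for m
      unfolding P_def
      by (subst sum.swap) (simp add: coeff_sum sum_distrib_left sum_divide_distrib)
    have low: "low_coeffs (Q a p) (\<Sum>i = 1..n. real (k a i) * w (p i))
        (\<Sum>i = 1..n. real (k a i) * (w (p i))\<^sup>2)" for a p
      unfolding Q_def by (intro low_coeffs_prod low_coeffs_power low_coeffs_linear) simp
    have "degree (Q a p) \<le> d" if "a \<in> A" for a p
    proof -
      have "degree (Q a p) \<le> (\<Sum>i = 1..n. degree ([:1, w (p i):] ^ k a i))"
        unfolding Q_def
        using degree_prod_sum_le[of "{1..n}" "\<lambda>i. [:1, w (p i):] ^ k a i"]
        by (simp only: o_def finite_atLeastAtMost simp_thms)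
      also have "\<dots> \<le> (\<Sum>i = 1..n. k a i)"
        by (intro sum_mono order.trans[OF degree_power_le]) auto
      finally show ?thesis using deg[OF that] by simp
    qed
    then have "degree P \<le> d"
      unfolding P_def
      by (intro order.trans[OF degree_smult_le] degree_sum_le)
        (auto intro!: degree_sum_le order.trans[OF degree_smult_le] simp: A finite_permutations)
    moreover have "poly P \<rho> = perm_avg n g (\<lambda>i. (1 + \<rho> * w i) / real n)" for \<rho>
    proof -
      have "c' a * poly (Q a p) \<rho> = c a * (\<Prod>i = 1..n. ((1 + \<rho> * w (p i)) / real n) ^ k a i)" for a p
        unfolding Q_def c'_def poly_prod
        by (simp add: power_divide prod_dividef power_sum mult.commute)
      then show ?thesis
        unfolding P_def perm_avg_def g_def by (simp add: poly_sum)
    qed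
    moreover have "coeff P 0 = a0"
      using low by (simp add: coeffP a0_def low_coeffs_def card_perms)
    moreover have "coeff P 1 = 0"
    proof -
      have "(\<Sum>p \<in> ?\<Pi>. coeff (Q a p) 1) = 0" for a
      proof -
        have "(\<Sum>p \<in> ?\<Pi>. coeff (Q a p) 1) = (\<Sum>i = 1..n. real (k a i) * (\<Sum>p \<in> ?\<Pi>. w (p i)))"
          using low by (simp add: low_coeffs_def sum_distrib_left) (rule sum.swap)
        also have "\<dots> = 0"
          by (intro sum.neutral ballI) (simp only: sum_perms_pair(1)[OF n w] mult_zero_right)
        finally show ?thesis .
      qed
      then show ?thesis by (simp add: coeffP)
    qed
    moreover have "coeff P 2 = c2 * W"
    proof -
      have "(\<Sum>p \<in> ?\<Pi>. coeff (Q a p) 2) / fact n =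
          ((\<Sum>i = 1..n. \<Sum>j = 1..n. real (k a i) * real (k a j) * \<gamma> i j) -
            (\<Sum>i = 1..n. real (k a i) * \<gamma> i i)) / 2 * W" for a
      proof -
        have "coeff (Q a p) 2 = ((\<Sum>i = 1..n. \<Sum>j = 1..n. real (k a i) * real (k a j) * (w (p i) * w (p j))) -
            (\<Sum>i = 1..n. real (k a i) * (w (p i) * w (p i)))) / 2" for p
          using low[of a p] unfolding low_coeffs_def power2_eq_square sum_product
          by (simp add: mult_ac)
        then have "(\<Sum>p \<in> ?\<Pi>. coeff (Q a p) 2) =
           ((\<Sum>p \<in> ?\<Pi>. \<Sum>i = 1..n. \<Sum>j = 1..n. real (k a i) * real (k a j) * (w (p i) * w (p j))) -
            (\<Sum>p \<in> ?\<Pi>. \<Sum>i = 1..n. real (k a i) * (w (p i) * w (p i)))) / 2"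
          by (simp only: sum_subtractf flip: sum_divide_distrib)
        also have "(\<Sum>p \<in> ?\<Pi>. \<Sum>i = 1..n. \<Sum>j = 1..n. real (k a i) * real (k a j) * (w (p i) * w (p j))) =
            (\<Sum>i = 1..n. \<Sum>j = 1..n. real (k a i) * real (k a j) * (\<Sum>p \<in> ?\<Pi>. w (p i) * w (p j)))"
          unfolding sum_distrib_left by (subst sum.swap, intro sum.cong refl, rule sum.swap)
        also have "\<dots> = (\<Sum>i = 1..n. \<Sum>j = 1..n. real (k a i) * real (k a j) * (fact n * \<gamma> i j * W))"
          unfolding \<gamma>_def by (intro sum.cong refl arg_cong[where f = "\<lambda>t. _ * t"] pair)
        also have "\<dots> = fact n * W * (\<Sum>i = 1..n. \<Sum>j = 1..n. real (k a i) * real (k a j) * \<gamma> i j)"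
          unfolding sum_distrib_left by (simp add: mult_ac)
        also have "(\<Sum>p \<in> ?\<Pi>. \<Sum>i = 1..n. real (k a i) * (w (p i) * w (p i))) =
            (\<Sum>i = 1..n. real (k a i) * (\<Sum>p \<in> ?\<Pi>. w (p i) * w (p i)))"
          unfolding sum_distrib_left by (rule sum.swap)
        also have "\<dots> = (\<Sum>i = 1..n. real (k a i) * (fact n * \<gamma> i i * W))"
          unfolding \<gamma>_def by (intro sum.cong refl arg_cong[where f = "\<lambda>t. _ * t"] pair)
        also have "\<dots> = fact n * W * (\<Sum>i = 1..n. real (k a i) * \<gamma> i i)"
          unfolding sum_distrib_left by (simp add: mult_ac)
        finally show ?thesis by (simp add: field_simps)
      qed
      then show ?thesis
        unfolding coeffP c2_def sum_distrib_right by (simp only: mult.assoc)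
    qed
    ultimately show ?thesis unfolding W_def by blast
  qed
  then show ?thesis by blast
qed

subsection \<open>A functional with a negative point mass\<close>

text \<open>The nodes are distinct, as interpolation requires, and at most one half, so that
  \<open>1 - \<rho>\<close> stays at least one half.\<close>

definition node :: "nat \<Rightarrow> real"
  where "node j = 1 / (real j + 2)"

lemma node_bounds: "0 < node j" "node j \<le> 1 / 2"
  by (auto simp: node_def field_simps)

lemma inj_node: "inj_on node A"
  by (auto simp: node_def inj_on_def)

text \<open>The point with \<open>\<rho> = 0\<close> carries the negative mass \<open>- (b ^ 25 - b ^ 24)\<close>. Since \<open>P\<close> has no
  linear term, the defect against the positive mass \<open>b ^ 25\<close> at \<open>\<rho> = b ^ -5\<close> is controlled by the
  quadratic coefficient, which the values of \<open>R\<close> bound, and by higher coefficients, which carry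
  a factor \<open>b ^ -15\<close>.\<close>

lemma reduced_mass_nonneg:
  fixes b :: real and P R :: "real poly"
  assumes C: "C > 0" "\<And>p k. degree p \<le> d \<Longrightarrow> (coeff p k)\<^sup>2 \<le> C * (\<Sum>j\<le>d. (poly p (node j))\<^sup>2)"
    and b: "b \<ge> 1 + 4 * real d + 16 * C * 2 ^ d + 4 * (real d + 1)\<^sup>2 * C * 2 ^ d"
    and P: "degree P \<le> d" "coeff P 0 = a" "coeff P 1 = 0"
    and R: "degree R \<le> d" "coeff R 2 = \<theta> * coeff P 2"
    and \<theta>: "\<theta> \<ge> 1 / (2 * b ^ 8)" and s: "s \<le> d"
  shows "0 \<le> b ^ 25 * ((1 - 1 / b ^ 5) ^ s * (poly P (1 / b ^ 5))\<^sup>2) - (b ^ 25 - b ^ 24) * a\<^sup>2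
    + b ^ 24 * (\<Sum>j\<le>d. (1 / 2) ^ s * (poly R (node j))\<^sup>2) + (\<Sum>j\<le>d. (1 / 2) ^ s * (poly P (node j))\<^sup>2)"
proof -
  define t where "t = 1 / b ^ 5"
  define \<beta> where "\<beta> = coeff P 2"
  define X where "X = (\<Sum>j\<le>d. (poly P (node j))\<^sup>2)"
  define Z where "Z = (\<Sum>j\<le>d. (poly R (node j))\<^sup>2)"
  have XZ: "X \<ge> 0" "Z \<ge> 0" by (auto simp: X_def Z_def intro: sum_nonneg)
  have pos: "0 \<le> 16 * C * 2 ^ d" "0 \<le> 4 * (real d + 1)\<^sup>2 * C * 2 ^ d" using C by auto
  have b1: "b \<ge> 1" using b pos by linarith
  have t: "0 < t" "t \<le> 1" using b1 by (auto simp: t_def field_simps)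
  have bpow: "b \<le> b ^ k" if "k > 0" for k
    using power_increasing[of 1 k b] that b1 by simp

  \<comment> \<open>The three lowest coefficients are split off; \<open>Q\<close> carries all terms
    of order at least three.\<close>
  obtain a' p1 where p1: "P = pCons a' p1" by (rule pCons_cases)
  obtain z p2 where p2: "p1 = pCons z p2" by (rule pCons_cases)
  obtain \<beta>' Q where Q: "p2 = pCons \<beta>' Q" by (rule pCons_cases)
  have coeffQ: "coeff Q k = coeff P (k + 3)" for k
    by (simp add: p1 p2 Q numeral_3_eq_3)
  have PQ: "poly P x = a + \<beta> * x\<^sup>2 + x ^ 3 * poly Q x" for x
    using P by (simp add: p1 p2 Q \<beta>_def numeral_2_eq_2 power2_eq_square power3_eq_cube algebra_simps)
  have degQ: "degree Q \<le> d"
  proof (rule degree_le, intro allI impI)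
    fix i assume "d < i"
    then show "coeff Q i = 0" using P(1) by (auto simp: coeffQ intro!: coeff_eq_0)
  qed

  define r where "r = poly Q t"
  \<comment> \<open>Coefficients of \<open>Q\<close> are coefficients of \<open>P\<close>, hence
    controlled by \<open>X\<close>, and the powers of \<open>t\<close> are at most
    \<open>1\<close>.\<close>
  have r: "r\<^sup>2 \<le> (real d + 1)\<^sup>2 * C * X"
  proof -
    have "r = (\<Sum>i\<le>degree Q. coeff Q i * t ^ i)"
      by (simp add: r_def poly_altdef)
    then have "r\<^sup>2 \<le> (\<Sum>i\<le>degree Q. (coeff Q i)\<^sup>2) * (\<Sum>i\<le>degree Q. (t ^ i)\<^sup>2)"
      using Cauchy_Schwarz_ineq_sum[of "coeff Q" "\<lambda>i. t ^ i"] by simp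
    also have "\<dots> \<le> (\<Sum>i\<le>degree Q. C * X) * (\<Sum>i\<le>degree Q. 1)"
      using t C(1) XZ
      by (intro mult_mono sum_mono sum_nonneg)
        (auto simp: coeffQ X_def power_le_one intro: C(2)[OF P(1)])
    also have "\<dots> = (real (degree Q) + 1)\<^sup>2 * (C * X)"
      by (simp add: power2_eq_square algebra_simps)
    also have "\<dots> \<le> (real d + 1)\<^sup>2 * (C * X)"
      using degQ C(1) XZ by (intro mult_right_mono power_mono) auto
    finally show ?thesis by (simp add: mult_ac)
  qed
  have \<beta>: "\<beta>\<^sup>2 \<le> 4 * b ^ 16 * C * Z"
  proof -
    have "(1 / (2 * b ^ 8))\<^sup>2 * \<beta>\<^sup>2 \<le> \<theta>\<^sup>2 * \<beta>\<^sup>2"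
      using \<theta> b1 by (intro mult_right_mono power_mono) auto
    also have "\<dots> = (coeff R 2)\<^sup>2" by (simp add: R \<beta>_def power_mult_distrib)
    also have "\<dots> \<le> C * Z" unfolding Z_def by (rule C(2)[OF R(1)])
    finally have "(2 * b ^ 8)\<^sup>2 * ((1 / (2 * b ^ 8))\<^sup>2 * \<beta>\<^sup>2) \<le> (2 * b ^ 8)\<^sup>2 * (C * Z)"
      by (rule mult_left_mono) simp
    then show ?thesis using b1 by (simp add: power_mult_distrib power_divide mult_ac flip: power_mult)
  qed

  \<comment> \<open>The positive mass after the loss \<open>(1 - t) ^ s\<close> coming from the
    weight. The net amount \<open>b ^ 24 * a\<^sup>2\<close> left by the two large masses is spent
    in quarters: one on this loss, one each on \<open>e1\<close> and \<open>e2\<close>, and one to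
    spare.\<close>
  define W' where "W' = b ^ 25 * (1 - t) ^ s"
  have W'le: "W' \<le> b ^ 25" "W' \<ge> 0"
    unfolding W'_def using t b1 by (auto intro!: mult_left_le power_le_one)
  have W'ge: "b ^ 25 - b ^ 24 / 4 \<le> W'"
  proof -
    have "1 - real s * t \<le> (1 - t) ^ s"
      using Bernoulli_inequality[of "- t" s] t by simp
    then have "b ^ 25 * (1 - real s * t) \<le> W'"
      unfolding W'_def using b1 by (intro mult_left_mono) auto
    moreover have bt: "b ^ 25 * t = b ^ 20"
      using b1 by (simp add: t_def field_simps flip: power_add)
    moreover have "real s * b ^ 20 \<le> b ^ 24 / 4"
    proof -
      have "real s \<le> real d" using s by simp
      then have "4 * real s \<le> b ^ 4" using bpow[of 4] b pos by linarith
      then have "4 * real s * b ^ 20 \<le> b ^ 4 * b ^ 20" using b1 by (intro mult_right_mono) auto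
      then show ?thesis by (simp flip: power_add)
    qed
    moreover have "b ^ 25 * (1 - real s * t) = b ^ 25 - real s * b ^ 20"
      unfolding bt[symmetric] by (simp add: algebra_simps)
    ultimately show ?thesis by linarith
  qed

  \<comment> \<open>The mixed term has size \<open>b ^ 15 = b ^ 12 * b ^ 3\<close>, split so that
    the part in \<open>a\<close> costs one quarter. In \<open>e2\<close> the split is
    \<open>b ^ 10 = b ^ 12 / b ^ 2\<close>.\<close>
  have e1: "2 * W' * (\<bar>a\<bar> * \<bar>\<beta>\<bar> * t\<^sup>2) \<le> b ^ 24 / 4 * a\<^sup>2 + 4 * b ^ 6 * \<beta>\<^sup>2"
  proof -
    have "W' * (\<bar>a\<bar> * \<bar>\<beta>\<bar> * t\<^sup>2) \<le> b ^ 25 * (\<bar>a\<bar> * \<bar>\<beta>\<bar> * t\<^sup>2)"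
      using W'le by (intro mult_right_mono) auto
    also have "b ^ 25 * (\<bar>a\<bar> * \<bar>\<beta>\<bar> * t\<^sup>2) = b ^ 15 * (\<bar>a\<bar> * \<bar>\<beta>\<bar>)"
      using b1 by (simp add: t_def field_simps flip: power_mult power_add)
    finally have "2 * W' * (\<bar>a\<bar> * \<bar>\<beta>\<bar> * t\<^sup>2) \<le> 2 * (b ^ 12 * \<bar>a\<bar> / 2) * (2 * b ^ 3 * \<bar>\<beta>\<bar>)"
      by (simp add: mult_ac flip: power_add)
    also have "\<dots> \<le> (b ^ 12 * \<bar>a\<bar> / 2)\<^sup>2 + (2 * b ^ 3 * \<bar>\<beta>\<bar>)\<^sup>2"
      by (rule sum_squares_bound)
    also have "\<dots> = b ^ 24 / 4 * a\<^sup>2 + 4 * b ^ 6 * \<beta>\<^sup>2"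
      by (simp add: power_mult_distrib power_divide flip: power_mult)
    finally show ?thesis .
  qed
  have e2: "2 * W' * (\<bar>a\<bar> * \<bar>r\<bar> * t ^ 3) \<le> b ^ 24 / 4 * a\<^sup>2 + 4 / b ^ 4 * r\<^sup>2"
  proof -
    have "2 * W' * (\<bar>a\<bar> * \<bar>r\<bar> * t ^ 3) \<le> 2 * b ^ 25 * (\<bar>a\<bar> * \<bar>r\<bar> * t ^ 3)"
      using W'le t by (intro mult_right_mono) auto
    also have "2 * b ^ 25 * (\<bar>a\<bar> * \<bar>r\<bar> * t ^ 3) = 2 * (b ^ 10 * (\<bar>a\<bar> * \<bar>r\<bar>))"
      using b1 by (simp add: t_def field_simps flip: power_mult power_add)
    also have "2 * (b ^ 10 * (\<bar>a\<bar> * \<bar>r\<bar>)) = 2 * (b ^ 12 * \<bar>a\<bar> / 2) * (2 / b ^ 2 * \<bar>r\<bar>)"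
      using b1 by (simp add: field_simps flip: power_add)
    finally have "2 * W' * (\<bar>a\<bar> * \<bar>r\<bar> * t ^ 3) \<le> 2 * (b ^ 12 * \<bar>a\<bar> / 2) * (2 / b ^ 2 * \<bar>r\<bar>)" .
    also have "\<dots> \<le> (b ^ 12 * \<bar>a\<bar> / 2)\<^sup>2 + (2 / b ^ 2 * \<bar>r\<bar>)\<^sup>2"
      by (rule sum_squares_bound)
    also have "\<dots> = b ^ 24 / 4 * a\<^sup>2 + 4 / b ^ 4 * r\<^sup>2"
      by (simp add: power_mult_distrib power_divide flip: power_mult)
    finally show ?thesis .
  qed
  have bC: "16 * C * 2 ^ d \<le> b\<^sup>2" "4 * (real d + 1)\<^sup>2 * C * 2 ^ d \<le> b ^ 4"
    using bpow[of 2] bpow[of 4] b pos by linarith+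
  have half: "(1 / 2) ^ d \<le> (1 / 2 :: real) ^ s"
    using s by (intro power_decreasing) auto
  \<comment> \<open>The bound on \<open>\<beta>\<close> costs \<open>b ^ 16\<close>, which makes
    \<open>b ^ 22\<close> in all; the remaining factor \<open>b\<^sup>2\<close> of the mass
    \<open>b ^ 24\<close> beats the constants.\<close>
  have e3: "4 * b ^ 6 * \<beta>\<^sup>2 \<le> b ^ 24 * ((1 / 2) ^ s * Z)"
  proof -
    have "4 * b ^ 6 * \<beta>\<^sup>2 \<le> 4 * b ^ 6 * (4 * b ^ 16 * C * Z)"
      using \<beta> b1 by (intro mult_left_mono) auto
    also have "\<dots> = b ^ 22 * ((16 * C * 2 ^ d) * ((1 / 2) ^ d * Z))"
      by (simp add: power_one_over flip: power_add)
    also have "\<dots> \<le> b ^ 22 * (b\<^sup>2 * ((1 / 2) ^ s * Z))"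
      using bC b1 XZ half by (intro mult_left_mono mult_mono) auto
    also have "\<dots> = b ^ 24 * ((1 / 2) ^ s * Z)"
      by (simp add: mult.assoc[symmetric] flip: power_add)
    finally show ?thesis .
  qed
  have e4: "4 / b ^ 4 * r\<^sup>2 \<le> (1 / 2) ^ s * X"
  proof -
    have "4 / b ^ 4 * r\<^sup>2 \<le> 4 / b ^ 4 * ((real d + 1)\<^sup>2 * C * X)"
      using r b1 by (intro mult_left_mono) auto
    also have "\<dots> = (4 * (real d + 1)\<^sup>2 * C * 2 ^ d) / b ^ 4 * ((1 / 2) ^ d * X)"
      by (simp add: power_one_over)
    also have "\<dots> \<le> 1 * ((1 / 2) ^ s * X)"
      using bC b1 XZ half by (intro mult_mono) (auto simp: divide_le_eq_1)
    finally show ?thesis by simp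
  qed
  have "(a + (\<beta> * t\<^sup>2 + t ^ 3 * r))\<^sup>2 \<ge> a\<^sup>2 - 2 * (\<bar>a\<bar> * \<bar>\<beta>\<bar> * t\<^sup>2) - 2 * (\<bar>a\<bar> * \<bar>r\<bar> * t ^ 3)"
  proof -
    have "(a + (\<beta> * t\<^sup>2 + t ^ 3 * r))\<^sup>2 \<ge> a\<^sup>2 + 2 * (a * \<beta> * t\<^sup>2) + 2 * (a * r * t ^ 3)"
      using zero_le_power2[of "\<beta> * t\<^sup>2 + t ^ 3 * r"] unfolding power2_sum by (simp add: algebra_simps)
    moreover have "- (a * \<beta> * t\<^sup>2) \<le> \<bar>a\<bar> * \<bar>\<beta>\<bar> * t\<^sup>2" "- (a * r * t ^ 3) \<le> \<bar>a\<bar> * \<bar>r\<bar> * t ^ 3"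
      using t abs_ge_minus_self[of "a * \<beta> * t\<^sup>2"] abs_ge_minus_self[of "a * r * t ^ 3"]
      by (simp_all add: abs_mult)
    ultimately show ?thesis by linarith
  qed
  then have "W' * (a\<^sup>2 - 2 * (\<bar>a\<bar> * \<bar>\<beta>\<bar> * t\<^sup>2) - 2 * (\<bar>a\<bar> * \<bar>r\<bar> * t ^ 3)) \<le> W' * (poly P t)\<^sup>2"
    using W'le by (intro mult_left_mono) (auto simp: PQ r_def add.assoc)
  then have h1: "W' * a\<^sup>2 - 2 * W' * (\<bar>a\<bar> * \<bar>\<beta>\<bar> * t\<^sup>2) - 2 * W' * (\<bar>a\<bar> * \<bar>r\<bar> * t ^ 3) \<le> W' * (poly P t)\<^sup>2"
    by (simp only: right_diff_distrib mult.assoc mult.left_commute[of W' 2])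
  have "(b ^ 25 - b ^ 24 / 4) * a\<^sup>2 \<le> W' * a\<^sup>2"
    using W'ge by (intro mult_right_mono) auto
  then have h2: "b ^ 25 * a\<^sup>2 - b ^ 24 / 4 * a\<^sup>2 \<le> W' * a\<^sup>2"
    by (simp only: left_diff_distrib)
  have h3: "b ^ 24 * a\<^sup>2 = 4 * (b ^ 24 / 4 * a\<^sup>2)" by simp
  have h4: "0 \<le> b ^ 24 / 4 * a\<^sup>2" using b1 by simp
  \<comment> \<open>The bookkeeping is done in abstract real variables, where it is purely linear;
    \<open>p\<close> is one quarter of the net amount.\<close>
  have "0 \<le> V - (Q - P) + z + x"
    if "w - e - f \<le> V" "Q - p \<le> w" "P = 4 * p" "0 \<le> p" "e \<le> p + y" "f \<le> p + v" "y \<le> z" "v \<le> x"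
    for V Q P p w e f x y z v :: real
    using that by linarith
  from this[OF h1 h2 h3 h4 e1 e2 e3 e4]
  have "0 \<le> W' * (poly P t)\<^sup>2 - (b ^ 25 - b ^ 24) * a\<^sup>2 + b ^ 24 * ((1 / 2) ^ s * Z) + (1 / 2) ^ s * X"
    by (simp only: left_diff_distrib)
  then show ?thesis
    by (simp add: W'_def t_def X_def Z_def sum_distrib_left mult.assoc)
qed

section \<open>Lines through the vacuum and the functional supported on them\<close>

definition block_dir :: "nat \<Rightarrow> nat \<Rightarrow> nat \<Rightarrow> real"
  where "block_dir n M i = (if i \<le> M then real n / real M - 1 else - 1)"

text \<open>For \<open>1 \<le> M \<le> n\<close> this is the segment from the vacuum at
  \<open>\<rho> = 0\<close> to the uniform point on the first \<open>M\<close> coordinates at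
  \<open>\<rho> = 1\<close>.\<close>

definition block_point :: "nat \<Rightarrow> nat \<Rightarrow> real \<Rightarrow> nat \<Rightarrow> real"
  where "block_point n M \<rho> i = (1 + \<rho> * block_dir n M i) / real n"

lemma sum_block:
  assumes "M \<le> n"
  shows "(\<Sum>i = 1..n. if i \<le> M then x else y) = real M * x + (real n - real M) * (y :: real)"
proof -
  have "{1..n} \<inter> {i. i \<le> M} = {1..M}" "{1..n} \<inter> - {i. i \<le> M} = {M<..n}"
    using assms by auto
  then show ?thesis
    using assms by (simp add: sum.If_cases of_nat_diff)
qed

lemma sum_block_dir:
  assumes "1 \<le> M" "M \<le> n"
  shows "(\<Sum>i = 1..n. block_dir n M i) = 0"
    and "(\<Sum>i = 1..n. (block_dir n M i)\<^sup>2) = (real n)\<^sup>2 / real M - real n"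
proof -
  show "(\<Sum>i = 1..n. block_dir n M i) = 0"
    unfolding block_dir_def sum_block[OF assms(2)] using assms by (simp add: field_simps)
  have "(\<Sum>i = 1..n. (block_dir n M i)\<^sup>2) =
      (\<Sum>i = 1..n. if i \<le> M then (real n / real M - 1)\<^sup>2 else 1)"
    by (intro sum.cong) (auto simp: block_dir_def)
  also have "\<dots> = (real n)\<^sup>2 / real M - real n"
    unfolding sum_block[OF assms(2)] using assms by (simp add: field_simps power2_eq_square)
  finally show "(\<Sum>i = 1..n. (block_dir n M i)\<^sup>2) = (real n)\<^sup>2 / real M - real n" .
qed

lemma block_point_ge:
  assumes "0 \<le> \<rho>"
  shows "(1 - \<rho>) / real n \<le> block_point n M \<rho> i"
proof -
  have "- 1 \<le> block_dir n M i" by (simp add: block_dir_def)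
  then have "\<rho> * (- 1) \<le> \<rho> * block_dir n M i" using assms by (intro mult_left_mono)
  then show ?thesis unfolding block_point_def by (intro divide_right_mono) auto
qed

text \<open>The term at \<open>\<rho> = 0\<close> is the vacuum with its negative mass. There are
  \<open>d + 1\<close> nodes on each line because that many values determine a polynomial of degree
  at most \<open>d\<close>.\<close>

definition pseudo_mean :: "nat \<Rightarrow> nat \<Rightarrow> ((nat \<Rightarrow> real) \<Rightarrow> real) \<Rightarrow> real"
  where "pseudo_mean d b h =
    real b ^ 25 * h (block_point (b ^ 10) 1 (1 / real b ^ 5))
    - (real b ^ 25 - real b ^ 24) * h (block_point (b ^ 10) 1 0)
    + real b ^ 24 * (\<Sum>j\<le>d. h (block_point (b ^ 10) (b ^ 8) (node j)))
    + (\<Sum>j\<le>d. h (block_point (b ^ 10) 1 (node j)))"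

lemma pseudo_mean_sum:
  "pseudo_mean d b (\<lambda>y. \<Sum>a \<in> A. h a y) = (\<Sum>a \<in> A. pseudo_mean d b (h a))"
  by (induction A rule: infinite_finite_induct)
    (simp_all add: pseudo_mean_def sum.distrib algebra_simps)

lemma pseudo_mean_cmult: "pseudo_mean d b (\<lambda>y. c * h y) = c * pseudo_mean d b h"
  by (simp add: pseudo_mean_def algebra_simps sum_distrib_left)

text \<open>Replacing the weight by a lower bound and the average of squares by the square of the
  average only lowers terms with nonnegative mass. The one negative mass sits at the vacuum, which
  is fixed by all permutations, so there the replacement is exact. What remains is
  \<open>reduced_mass_nonneg\<close>.\<close>

lemma pseudo_mean_square_nonneg:
  "\<exists>B. \<forall>b\<ge>B. \<forall>A (c :: 'a \<Rightarrow> real) k S. finite A \<longrightarrow> (\<forall>a \<in> A. (\<Sum>i = 1..b ^ 10. k a i) \<le> d) \<longrightarrow>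
    S \<subseteq> {1..b ^ 10} \<longrightarrow> card S \<le> d \<longrightarrow>
    0 \<le> pseudo_mean d b (perm_avg (b ^ 10)
      (\<lambda>y. (\<Prod>i \<in> S. y i) * (\<Sum>a \<in> A. c a * (\<Prod>i = 1..b ^ 10. y i ^ k a i))\<^sup>2))"
proof -
  obtain C where C: "C > 0" "\<And>p k. degree p \<le> d \<Longrightarrow> (coeff p k)\<^sup>2 \<le> C * (\<Sum>j\<le>d. (poly p (node j))\<^sup>2)"
    using coeff_le_values[OF inj_node] by blast
  \<comment> \<open>One more than \<open>reduced_mass_nonneg\<close> requires, which also gives
    \<open>b \<ge> 2\<close>.\<close>
  define B where "B = nat \<lceil>2 + 4 * real d + 16 * C * 2 ^ d + 4 * (real d + 1)\<^sup>2 * C * 2 ^ d\<rceil>"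
  have "0 \<le> pseudo_mean d b (perm_avg (b ^ 10)
      (\<lambda>y. (\<Prod>i \<in> S. y i) * (\<Sum>a \<in> A. c a * (\<Prod>i = 1..b ^ 10. y i ^ k a i))\<^sup>2))"
    if b: "b \<ge> B" and A: "finite A" and deg: "\<And>a. a \<in> A \<Longrightarrow> (\<Sum>i = 1..b ^ 10. k a i) \<le> d"
      and S: "S \<subseteq> {1..b ^ 10}" and s: "card S \<le> d" for b A S and c :: "'a \<Rightarrow> real" and k
  proof -
    define n where "n = b ^ 10"
    define M where "M = b ^ 8"
    define t where "t = 1 / real b ^ 5"
    define s where "s = card S"
    define g where "g = (\<lambda>y. \<Sum>a \<in> A. c a * (\<Prod>i = 1..n. y i ^ k a i))"
    define h where "h = perm_avg n (\<lambda>y. (\<Prod>i \<in> S. y i) * (g y)\<^sup>2)"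
    have Cpos: "0 \<le> 16 * C * 2 ^ d" "0 \<le> 4 * (real d + 1)\<^sup>2 * C * 2 ^ d" using C by auto
    have bB: "2 + 4 * real d + 16 * C * 2 ^ d + 4 * (real d + 1)\<^sup>2 * C * 2 ^ d \<le> real b"
      using b unfolding B_def by linarith
    then have b2: "real b \<ge> 2" using Cpos by linarith
    have bn: "b \<ge> 2" using b2 by simp
    have M1: "1 \<le> M" unfolding M_def using bn by simp
    have "2 ^ 2 * b ^ 8 \<le> b ^ 2 * b ^ 8" using bn by (intro mult_right_mono power_mono) auto
    then have Mn: "2 * M \<le> n" unfolding M_def n_def by (simp flip: power_add)
    have n2: "n \<ge> 2" using Mn M1 by linarith
    have t01: "0 \<le> t" "t \<le> 1" unfolding t_def using b2 by (auto simp: divide_le_eq_1)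
    obtain a0 c2 where line: "\<And>w. (\<Sum>i = 1..n. w i) = 0 \<Longrightarrow>
      \<exists>P. degree P \<le> d \<and> (\<forall>\<rho>. poly P \<rho> = perm_avg n g (\<lambda>i. (1 + \<rho> * w i) / real n)) \<and>
        coeff P 0 = a0 \<and> coeff P 1 = 0 \<and> coeff P 2 = c2 * (\<Sum>i = 1..n. (w i)\<^sup>2)"
      using perm_avg_line[where c = c and k = k, OF n2 A deg[folded n_def]] unfolding g_def by blast
    have ex: "\<exists>P. degree P \<le> d \<and> (\<forall>\<rho>. poly P \<rho> = perm_avg n g (block_point n M \<rho>)) \<and>
        coeff P 0 = a0 \<and> coeff P 1 = 0 \<and> coeff P 2 = c2 * ((real n)\<^sup>2 / real M - real n)"
      if "1 \<le> M" "M \<le> n" for M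
      using line[OF sum_block_dir(1)[OF that]] unfolding sum_block_dir(2)[OF that]
      by (simp add: block_point_def[abs_def])
    obtain P where P: "degree P \<le> d" "\<And>\<rho>. poly P \<rho> = perm_avg n g (block_point n 1 \<rho>)"
        "coeff P 0 = a0" "coeff P 1 = 0" "coeff P 2 = c2 * ((real n)\<^sup>2 / real 1 - real n)"
      using ex[of 1] n2 by auto
    obtain R where R: "degree R \<le> d" "\<And>\<rho>. poly R \<rho> = perm_avg n g (block_point n M \<rho>)"
        "coeff R 2 = c2 * ((real n)\<^sup>2 / real M - real n)"
      using ex[of M] M1 Mn by auto
    \<comment> \<open>The ratio of the squared lengths of the two directions; since
      \<open>c2\<close> is common to both lines, it carries the quadratic coefficient of
      \<open>P\<close> to that of \<open>R\<close>.\<close>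
    define \<theta> where "\<theta> = ((real n)\<^sup>2 / real M - real n) / ((real n)\<^sup>2 - real n)"
    have nn: "(real n)\<^sup>2 - real n > 0"
      using n2 by (simp add: power2_eq_square)
    have \<theta>: "\<theta> \<ge> 1 / (2 * real b ^ 8)"
    proof -
      have "real n + 1 \<ge> 2 * real M" using Mn by linarith
      then have "real n * (2 * real M) \<le> real n * (real n + 1)" by (intro mult_left_mono) auto
      then have "(real n)\<^sup>2 - real n \<le> 2 * real M * ((real n)\<^sup>2 / real M - real n)"
        using M1 by (simp add: algebra_simps power2_eq_square)
      then have "1 / (2 * real M) \<le> \<theta>"
        unfolding \<theta>_def using M1 nn by (simp add: field_simps)
      then show ?thesis by (simp add: M_def)
    qed
    have R2: "coeff R 2 = \<theta> * coeff P 2"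
      unfolding R(3) P(5) \<theta>_def using nn by simp
    have hge: "((1 - \<rho>) / real n) ^ s * (perm_avg n g (block_point n N \<rho>))\<^sup>2 \<le> h (block_point n N \<rho>)"
      if "0 \<le> \<rho>" "\<rho> \<le> 1" for \<rho> N
      unfolding h_def s_def using that S
      by (intro perm_avg_weighted_square_ge block_point_ge) (auto simp: n_def)
    have hnode: "(1 / real n) ^ s * ((1 / 2) ^ s * (perm_avg n g (block_point n N (node j)))\<^sup>2)
        \<le> h (block_point n N (node j))" for N j
    proof -
      have "(1 / 2) / real n \<le> (1 - node j) / real n"
        using node_bounds[of j] by (intro divide_right_mono) auto
      then have "(1 / real n) ^ s * (1 / 2) ^ s \<le> ((1 - node j) / real n) ^ s"
        unfolding power_mult_distrib[symmetric] by (intro power_mono) auto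
      then have "(1 / real n) ^ s * (1 / 2) ^ s * (perm_avg n g (block_point n N (node j)))\<^sup>2
        \<le> ((1 - node j) / real n) ^ s * (perm_avg n g (block_point n N (node j)))\<^sup>2"
        by (intro mult_right_mono) auto
      also have "\<dots> \<le> h (block_point n N (node j))"
        using node_bounds[of j] by (intro hge) auto
      finally show ?thesis by (simp add: mult.assoc)
    qed
    have h0: "h (block_point n 1 0) = (1 / real n) ^ s * a0\<^sup>2"
    proof -
      have "block_point n 1 0 = (\<lambda>i. 1 / real n)"
        by (simp add: block_point_def[abs_def])
      then have "a0 = g (\<lambda>i. 1 / real n)" "h (block_point n 1 0) = (\<Prod>i \<in> S. 1 / real n) * (g (\<lambda>i. 1 / real n))\<^sup>2"
        using P(2)[of 0] P(3) by (simp_all add: h_def perm_avg_const poly_0_coeff_0)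
      then show ?thesis by (simp add: s_def)
    qed
    have "0 \<le> (1 / real n) ^ s * (real b ^ 25 * ((1 - t) ^ s * (poly P t)\<^sup>2) - (real b ^ 25 - real b ^ 24) * a0\<^sup>2
        + real b ^ 24 * (\<Sum>j\<le>d. (1 / 2) ^ s * (poly R (node j))\<^sup>2)
        + (\<Sum>j\<le>d. (1 / 2) ^ s * (poly P (node j))\<^sup>2))"
      unfolding t_def using bB that(5)
      by (intro mult_nonneg_nonneg reduced_mass_nonneg[OF C _ P(1) P(3) P(4) R(1) R2 \<theta>])
        (auto simp: s_def)
    also have "\<dots> = real b ^ 25 * (((1 - t) / real n) ^ s * (poly P t)\<^sup>2)
        - (real b ^ 25 - real b ^ 24) * h (block_point n 1 0)
        + real b ^ 24 * (\<Sum>j\<le>d. (1 / real n) ^ s * ((1 / 2) ^ s * (poly R (node j))\<^sup>2))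
        + (\<Sum>j\<le>d. (1 / real n) ^ s * ((1 / 2) ^ s * (poly P (node j))\<^sup>2))"
      unfolding h0 by (simp add: algebra_simps sum_distrib_left power_divide)
    also have "\<dots> \<le> pseudo_mean d b h"
      unfolding pseudo_mean_def P(2) R(2)
      using t01 hnode hge[OF t01, of 1] b2
      by (intro add_mono diff_right_mono mult_left_mono sum_mono)
        (auto simp: n_def[symmetric] M_def[symmetric] t_def[symmetric])
    finally show ?thesis by (simp add: h_def g_def n_def)
  qed
  then show ?thesis by (intro exI[of _ B]) blast
qed

subsection \<open>Positivity on sums of squares\<close>

text \<open>Along the ray through \<open>x\<close> the polynomial is univariate in the scale, and
  the growth bound kills all degrees above \<open>d\<close>. Only the value at \<open>x\<close> is
  concerned: the higher monomials cancel there, degree by degree.\<close>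

lemma low_degree_of_growth:
  assumes q: "q \<in> polys n"
    and growth: "\<And>s. s > 0 \<Longrightarrow> (meval (\<lambda>i. s * x i) q)\<^sup>2 \<le> B * s ^ (2 * d)"
  defines "A \<equiv> {m \<in> Poly_Mapping.keys q. (\<Sum>i = 1..n. Poly_Mapping.lookup m i) \<le> d}"
  shows "meval x q = (\<Sum>m \<in> A. Poly_Mapping.lookup q m * (\<Prod>i = 1..n. x i ^ Poly_Mapping.lookup m i))"
proof -
  define v where "v m = Poly_Mapping.lookup q m * (\<Prod>i = 1..n. x i ^ Poly_Mapping.lookup m i)" for m
  define \<delta> where "\<delta> m = (\<Sum>i = 1..n. Poly_Mapping.lookup m i)" for m :: "nat \<Rightarrow>\<^sub>0 nat"
  let ?K = "Poly_Mapping.keys q"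
  have ev: "meval z q = (\<Sum>m \<in> ?K. Poly_Mapping.lookup q m * (\<Prod>i = 1..n. z i ^ Poly_Mapping.lookup m i))" for z
    unfolding meval_superset[OF finite_keys order_refl] using q
    by (intro sum.cong refl) (simp add: polys_def mon_eval_superset[of "{1..n}"])
  define r where "r = (\<Sum>m \<in> ?K. monom (v m) (\<delta> m))"
  have "poly r s = meval (\<lambda>i. s * x i) q" for s
    unfolding r_def ev v_def \<delta>_def
    by (simp add: poly_sum poly_monom power_mult_distrib prod.distrib power_sum mult_ac)
  then have r0: "coeff r k = 0" if "k > d" for k
    using coeff_eq_0_of_growth[of r B d k] growth that by simp
  have "(\<Sum>m \<in> ?K - A. monom (v m) (\<delta> m)) = 0"
  proof (rule poly_eqI)
    fix k
    show "coeff (\<Sum>m \<in> ?K - A. monom (v m) (\<delta> m)) k = coeff 0 k"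
    proof (cases "k > d")
      case True
      then have "coeff (\<Sum>m \<in> ?K - A. monom (v m) (\<delta> m)) k = coeff r k"
        unfolding r_def coeff_sum
        by (intro sum.mono_neutral_left) (auto simp: A_def \<delta>_def)
      then show ?thesis using r0[OF True] by simp
    next
      case False
      then show ?thesis
        unfolding coeff_sum coeff_0 by (intro sum.neutral ballI) (auto simp: A_def \<delta>_def)
    qed
  qed
  then have "poly (\<Sum>m \<in> ?K - A. monom (v m) (\<delta> m)) 1 = 0" by simp
  then have "(\<Sum>m \<in> ?K - A. v m) = 0" by (simp add: poly_sum poly_monom)
  moreover have "(\<Sum>m \<in> ?K. v m) = (\<Sum>m \<in> ?K - A. v m) + (\<Sum>m \<in> A. v m)"
    by (rule sum.subset_diff) (auto simp: A_def)
  ultimately show ?thesis unfolding ev v_def by simp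
qed

lemma sqrt_power: "y \<ge> 0 \<Longrightarrow> sqrt y ^ k = (if odd k then sqrt y else 1) * y ^ (k div 2)"
proof -
  assume y: "y \<ge> 0"
  have "sqrt y ^ k = sqrt y ^ (k mod 2 + 2 * (k div 2))" by simp
  also have "\<dots> = sqrt y ^ (k mod 2) * (sqrt y ^ 2) ^ (k div 2)"
    by (simp only: power_add power_mult)
  also have "k mod 2 = (if odd k then 1 else 0)" by presburger
  finally show ?thesis using y by (cases "odd k") simp_all
qed

definition low_keys :: "nat \<Rightarrow> nat \<Rightarrow> mpoly \<Rightarrow> nat set \<Rightarrow> (nat \<Rightarrow>\<^sub>0 nat) set"
  where "low_keys n d q S = {m \<in> Poly_Mapping.keys q. (\<Sum>i = 1..n. Poly_Mapping.lookup m i) \<le> d \<and>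
    {i \<in> {1..n}. odd (Poly_Mapping.lookup m i)} = S}"

lemma finite_low_keys: "finite (low_keys n d q S)"
  by (simp add: low_keys_def)

text \<open>The form depends only on squares of variables, so it is constant under sign changes of
  \<open>sqrt (y i)\<close>. Averaging the sum of squares over the signs separates parity classes,
  and the odd exponents of a class leave the factor \<open>\<Prod>i \<in> S. y i\<close> after
  squaring.\<close>

lemma sos_even_form:
  assumes sos: "ps_form (2 * d) n c = (\<Sum>q\<leftarrow>qs. q ^ 2)" and qs: "set qs \<subseteq> polys n"
    and y: "\<And>i. i \<in> {1..n} \<Longrightarrow> 0 \<le> y i"
  shows "(\<Sum>l \<in> even_partitions (2 * d). c l * psum_part n y l) =
    (\<Sum>j < length qs. \<Sum>S \<in> Pow {1..n}. (\<Prod>i \<in> S. y i) *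
      (\<Sum>m \<in> low_keys n d (qs ! j) S. Poly_Mapping.lookup (qs ! j) m *
        (\<Prod>i = 1..n. y i ^ (Poly_Mapping.lookup m i div 2)))\<^sup>2)"
proof -
  let ?F = "\<lambda>y. \<Sum>l \<in> even_partitions (2 * d). c l * psum_part n y l"
  let ?E = "{1..n} \<rightarrow>\<^sub>E {1, - 1 :: real}"
  let ?x = "\<lambda>i. sqrt (y i)"
  have fF: "meval z (ps_form (2 * d) n c) = ?F (\<lambda>i. (z i)\<^sup>2)" for z
    by (rule meval_ps_form_eq_psum_part)
  have fq: "meval z (ps_form (2 * d) n c) = (\<Sum>j < length qs. (meval z (qs ! j))\<^sup>2)" for z
    unfolding sos
    by (simp add: meval_sum_list meval_sum meval_power o_def sum_list_sum_nth atLeast0LessThan)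
  define A where "A q = {m \<in> Poly_Mapping.keys q. (\<Sum>i = 1..n. Poly_Mapping.lookup m i) \<le> d}" for q :: mpoly
  \<comment> \<open>A single square is at most the whole form, which is homogeneous of degree
    \<open>2 * d\<close>; hence each summand grows at most like \<open>s ^ d\<close> along
    rays.\<close>
  have low: "meval z (qs ! j) = (\<Sum>m \<in> A (qs ! j). Poly_Mapping.lookup (qs ! j) m *
      (\<Prod>i = 1..n. z i ^ Poly_Mapping.lookup m i))" if j: "j < length qs" for z j
    unfolding A_def
  proof (rule low_degree_of_growth)
    show "qs ! j \<in> polys n" using qs j by auto
    fix s :: real assume "s > 0"
    have "(meval (\<lambda>i. s * z i) (qs ! j))\<^sup>2 \<le> meval (\<lambda>i. s * z i) (ps_form (2 * d) n c)"
      unfolding fq using j by (intro member_le_sum) auto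
    also have "\<dots> = ?F (\<lambda>i. s\<^sup>2 * (z i)\<^sup>2)"
      unfolding fF by (simp add: power_mult_distrib)
    also have "\<dots> = ?F (\<lambda>i. (z i)\<^sup>2) * s ^ (2 * d)"
      unfolding sum_distrib_right
      by (intro sum.cong refl) (simp add: psum_part_homogeneous flip: power_mult)
    finally show "(meval (\<lambda>i. s * z i) (qs ! j))\<^sup>2 \<le> ?F (\<lambda>i. (z i)\<^sup>2) * s ^ (2 * d)" .
  qed
  have cardE: "card ?E = 2 ^ n" by (simp add: card_PiE numeral_2_eq_2)
  have sign: "meval (\<lambda>i. \<epsilon> i * ?x i) (ps_form (2 * d) n c) = ?F y" if \<epsilon>: "\<epsilon> \<in> ?E" for \<epsilon>
  proof -
    have "(\<epsilon> i * ?x i)\<^sup>2 = y i" if "i \<in> {1..n}" for i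
    proof -
      have "\<epsilon> i \<in> {1, - 1}" using \<epsilon> that by (rule PiE_mem)
      then have "(\<epsilon> i)\<^sup>2 = 1" by auto
      then show ?thesis using y[OF that] by (simp add: power_mult_distrib)
    qed
    then show ?thesis unfolding fF psum_part_def psum_def
      by (intro sum.cong refl arg_cong2[where f = "(*)"] arg_cong[where f = prod_mset] image_mset_cong) auto
  qed
  have parity: "(\<Sum>m \<in> {m \<in> A q. {i \<in> {1..n}. odd (Poly_Mapping.lookup m i)} = S}.
        Poly_Mapping.lookup q m * (\<Prod>i = 1..n. ?x i ^ Poly_Mapping.lookup m i))\<^sup>2 =
      (\<Prod>i \<in> S. y i) * (\<Sum>m \<in> low_keys n d q S. Poly_Mapping.lookup q m *
        (\<Prod>i = 1..n. y i ^ (Poly_Mapping.lookup m i div 2)))\<^sup>2"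
    if S: "S \<in> Pow {1..n}" for q S
  proof -
    have "(\<Prod>i = 1..n. ?x i ^ Poly_Mapping.lookup m i) =
        (\<Prod>i \<in> S. ?x i) * (\<Prod>i = 1..n. y i ^ (Poly_Mapping.lookup m i div 2))"
      if m: "{i \<in> {1..n}. odd (Poly_Mapping.lookup m i)} = S" for m
    proof -
      have "(\<Prod>i = 1..n. ?x i ^ Poly_Mapping.lookup m i) =
          (\<Prod>i = 1..n. (if odd (Poly_Mapping.lookup m i) then ?x i else 1) * y i ^ (Poly_Mapping.lookup m i div 2))"
        using y by (intro prod.cong refl sqrt_power) auto
      also have "\<dots> = (\<Prod>i \<in> {i \<in> {1..n}. odd (Poly_Mapping.lookup m i)}. ?x i) *
          (\<Prod>i = 1..n. y i ^ (Poly_Mapping.lookup m i div 2))"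
        unfolding prod.distrib by (subst prod.inter_filter) auto
      finally show ?thesis unfolding m .
    qed
    then have "(\<Sum>m \<in> low_keys n d q S. Poly_Mapping.lookup q m * (\<Prod>i = 1..n. ?x i ^ Poly_Mapping.lookup m i)) =
        (\<Prod>i \<in> S. ?x i) * (\<Sum>m \<in> low_keys n d q S. Poly_Mapping.lookup q m *
          (\<Prod>i = 1..n. y i ^ (Poly_Mapping.lookup m i div 2)))"
      unfolding sum_distrib_left by (intro sum.cong refl) (simp add: low_keys_def)
    moreover have "(\<Prod>i \<in> S. ?x i)\<^sup>2 = (\<Prod>i \<in> S. y i)"
      unfolding prod_power_distrib using S y by (intro prod.cong) auto
    moreover have "{m \<in> A q. {i \<in> {1..n}. odd (Poly_Mapping.lookup m i)} = S} = low_keys n d q S"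
      by (auto simp: A_def low_keys_def)
    ultimately show ?thesis by (simp add: power_mult_distrib)
  qed
  have "2 ^ n * ?F y = (\<Sum>\<epsilon> \<in> ?E. ?F y)"
    by (simp only: sum_constant cardE of_nat_power of_nat_numeral)
  also have "\<dots> = (\<Sum>\<epsilon> \<in> ?E. \<Sum>j < length qs. (meval (\<lambda>i. \<epsilon> i * ?x i) (qs ! j))\<^sup>2)"
    by (intro sum.cong refl) (simp only: sign flip: fq)
  also have "\<dots> = (\<Sum>j < length qs. \<Sum>\<epsilon> \<in> ?E. (meval (\<lambda>i. \<epsilon> i * ?x i) (qs ! j))\<^sup>2)"
    by (rule sum.swap)
  also have "\<dots> = (\<Sum>j < length qs. 2 ^ n * (\<Sum>S \<in> Pow {1..n}. (\<Prod>i \<in> S. y i) *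
      (\<Sum>m \<in> low_keys n d (qs ! j) S. Poly_Mapping.lookup (qs ! j) m *
        (\<Prod>i = 1..n. y i ^ (Poly_Mapping.lookup m i div 2)))\<^sup>2))"
  proof (intro sum.cong refl)
    fix j assume j: "j \<in> {..<length qs}"
    have "finite (A (qs ! j))" by (simp add: A_def)
    from sum_signs_square[OF finite_atLeastAtMost[of 1 n] this,
      where c = "Poly_Mapping.lookup (qs ! j)" and e = Poly_Mapping.lookup and x = ?x]
    have "(\<Sum>\<epsilon> \<in> ?E. (meval (\<lambda>i. \<epsilon> i * ?x i) (qs ! j))\<^sup>2) = 2 ^ n *
      (\<Sum>S \<in> Pow {1..n}. (\<Sum>m \<in> {m \<in> A (qs ! j). {i \<in> {1..n}. odd (Poly_Mapping.lookup m i)} = S}.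
        Poly_Mapping.lookup (qs ! j) m * (\<Prod>i = 1..n. ?x i ^ Poly_Mapping.lookup m i))\<^sup>2)"
      using j by (simp add: low)
    also have "\<dots> = 2 ^ n * (\<Sum>S \<in> Pow {1..n}. (\<Prod>i \<in> S. y i) *
      (\<Sum>m \<in> low_keys n d (qs ! j) S. Poly_Mapping.lookup (qs ! j) m *
        (\<Prod>i = 1..n. y i ^ (Poly_Mapping.lookup m i div 2)))\<^sup>2)"
      by (intro arg_cong[where f = "\<lambda>t. 2 ^ n * t"] sum.cong refl parity)
    finally show "(\<Sum>\<epsilon> \<in> ?E. (meval (\<lambda>i. \<epsilon> i * ?x i) (qs ! j))\<^sup>2) = \<dots>" .
  qed
  finally show ?thesis by (simp flip: sum_distrib_left)
qed

text \<open>The functional only sees \<open>\<rho>\<close> in the unit interval, where coordinates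
  are nonnegative and \<open>sos_even_form\<close> applies.\<close>

lemma pseudo_mean_cong:
  assumes "\<And>M \<rho>. 0 \<le> \<rho> \<Longrightarrow> \<rho> \<le> 1 \<Longrightarrow> h (block_point (b ^ 10) M \<rho>) = h' (block_point (b ^ 10) M \<rho>)"
    and "b \<ge> 1"
  shows "pseudo_mean d b h = pseudo_mean d b h'"
proof -
  have n: "0 \<le> node j" "node j \<le> 1" for j using node_bounds[of j] by linarith+
  have t: "0 \<le> 1 / real b ^ 5" "1 / real b ^ 5 \<le> 1"
    using assms(2) by (auto simp: divide_le_eq_1)
  show ?thesis unfolding pseudo_mean_def by (simp only: assms(1) n t order_refl zero_le_one)
qed

text \<open>The symmetric form equals its own permutation average, which
  \<open>sos_even_form\<close> splits into weighted squares;
  \<open>pseudo_mean_square_nonneg\<close> treats each of them.\<close>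

lemma pseudo_mean_dual:
  "\<exists>B. \<forall>b\<ge>B. \<forall>c \<in> BSigma (2 * d).
    0 \<le> (\<Sum>l \<in> even_partitions (2 * d). c l * pseudo_mean d b (\<lambda>y. psum_part (b ^ 10) y l))"
proof -
  obtain B where B: "\<forall>b\<ge>B. \<forall>A (c :: (nat \<Rightarrow>\<^sub>0 nat) \<Rightarrow> real) k S. finite A \<longrightarrow>
    (\<forall>a \<in> A. (\<Sum>i = 1..b ^ 10. k a i) \<le> d) \<longrightarrow> S \<subseteq> {1..b ^ 10} \<longrightarrow> card S \<le> d \<longrightarrow>
    0 \<le> pseudo_mean d b (perm_avg (b ^ 10)
      (\<lambda>y. (\<Prod>i \<in> S. y i) * (\<Sum>a \<in> A. c a * (\<Prod>i = 1..b ^ 10. y i ^ k a i))\<^sup>2))"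
    using pseudo_mean_square_nonneg[of d] by (elim exE)
  have "0 \<le> (\<Sum>l \<in> even_partitions (2 * d). c l * pseudo_mean d b (\<lambda>y. psum_part (b ^ 10) y l))"
    if b: "b \<ge> B + 2 * d + 1" and c: "c \<in> BSigma (2 * d)" for b c
  proof -
    define n where "n = b ^ 10"
    let ?F = "\<lambda>y. \<Sum>l \<in> even_partitions (2 * d). c l * psum_part n y l"
    have b1: "b \<ge> 1" using b by simp
    \<comment> \<open>Membership in \<open>BSigma\<close> is used for exactly \<open>b ^ 10\<close>
      variables, which must be at least \<open>2 * d\<close>.\<close>
    have "b ^ 1 \<le> b ^ 10" using b1 by (intro power_increasing) auto
    then have "n \<ge> 2 * d" using b by (simp add: n_def)
    then obtain qs where qs: "set qs \<subseteq> polys n" "ps_form (2 * d) n c = (\<Sum>q\<leftarrow>qs. q ^ 2)"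
      using c by (auto simp: BSigma_def is_sos_def)
    define T where "T j S = (\<lambda>y. (\<Prod>i \<in> S. y i) *
      (\<Sum>m \<in> low_keys n d (qs ! j) S. Poly_Mapping.lookup (qs ! j) m *
        (\<Prod>i = 1..n. y i ^ (Poly_Mapping.lookup m i div 2)))\<^sup>2)" for j S
    have F: "?F (block_point n M \<rho>) = (\<Sum>j < length qs. \<Sum>S \<in> Pow {1..n}. perm_avg n (T j S) (block_point n M \<rho>))"
      if "0 \<le> \<rho>" "\<rho> \<le> 1" for M \<rho>
    proof -
      let ?y = "block_point n M \<rho>"
      have nonneg: "0 \<le> ?y i" for i
        using order.trans[OF _ block_point_ge[OF that(1)]] that by simp
      have "?F ?y = perm_avg n ?F ?y"
        by (rule perm_avg_invariant[symmetric]) (simp add: psum_part_permute)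
      also have "\<dots> = perm_avg n (\<lambda>y. \<Sum>j < length qs. \<Sum>S \<in> Pow {1..n}. T j S y) ?y"
        unfolding T_def by (rule perm_avg_cong, rule sos_even_form[OF qs(2) qs(1)], rule nonneg)
      also have "\<dots> = (\<Sum>j < length qs. \<Sum>S \<in> Pow {1..n}. perm_avg n (T j S) ?y)"
        by (simp add: perm_avg_sum)
      finally show ?thesis .
    qed
    have "(\<Sum>l \<in> even_partitions (2 * d). c l * pseudo_mean d b (\<lambda>y. psum_part n y l)) = pseudo_mean d b ?F"
      by (simp add: pseudo_mean_sum pseudo_mean_cmult)
    also have "\<dots> = pseudo_mean d b (\<lambda>y. \<Sum>j < length qs. \<Sum>S \<in> Pow {1..n}. perm_avg n (T j S) y)"
      using b1 by (intro pseudo_mean_cong) (auto simp: F[unfolded n_def] n_def)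
    also have "\<dots> = (\<Sum>j < length qs. \<Sum>S \<in> Pow {1..n}. pseudo_mean d b (perm_avg n (T j S)))"
      by (simp add: pseudo_mean_sum)
    also have "\<dots> \<ge> 0"
    proof (intro sum_nonneg)
      fix j S assume S: "S \<in> Pow {1..n}"
      show "0 \<le> pseudo_mean d b (perm_avg n (T j S))"
      proof (cases "low_keys n d (qs ! j) S = {}")
        case True
        then show ?thesis by (simp add: T_def perm_avg_def pseudo_mean_def)
      next
        case False
        then obtain m where m: "(\<Sum>i = 1..n. Poly_Mapping.lookup m i) \<le> d"
            "{i \<in> {1..n}. odd (Poly_Mapping.lookup m i)} = S"
          by (auto simp: low_keys_def)
        \<comment> \<open>Each index in \<open>S\<close> carries an odd exponent, hence at least
          \<open>1\<close>, so the degree bound limits the size of \<open>S\<close>.\<close>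
        have "card S = (\<Sum>i \<in> S. 1)" by simp
        also have "\<dots> \<le> (\<Sum>i \<in> S. Poly_Mapping.lookup m i)"
          unfolding m(2)[symmetric] by (intro sum_mono) (auto elim!: oddE)
        also have "\<dots> \<le> (\<Sum>i = 1..n. Poly_Mapping.lookup m i)"
          using S by (intro sum_mono2) auto
        finally have "card S \<le> d" using m by simp
        moreover have "(\<Sum>i = 1..n. Poly_Mapping.lookup m i div 2) \<le> d" if "m \<in> low_keys n d (qs ! j) S" for m
        proof -
          have "(\<Sum>i = 1..n. Poly_Mapping.lookup m i div 2) \<le> (\<Sum>i = 1..n. Poly_Mapping.lookup m i)"
            by (intro sum_mono) simp
          then show ?thesis using that by (simp add: low_keys_def)
        qed
        ultimately show ?thesis
          unfolding T_def n_def using b S finite_low_keys by (intro B[rule_format]) (auto simp: n_def)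
      qed
    qed
    finally show ?thesis by (simp add: n_def)
  qed
  then show ?thesis by (intro exI[of _ "B + 2 * d + 1"]) blast
qed

subsection \<open>Moments of the functional\<close>

lemma psum_block_point:
  assumes "M \<le> n"
  shows "psum n (block_point n M \<rho>) k =
    real M * ((1 + \<rho> * (real n / real M - 1)) / real n) ^ k + (real n - real M) * ((1 - \<rho>) / real n) ^ k"
proof -
  have "psum n (block_point n M \<rho>) k =
      (\<Sum>i = 1..n. if i \<le> M then ((1 + \<rho> * (real n / real M - 1)) / real n) ^ k else ((1 - \<rho>) / real n) ^ k)"
    unfolding psum_def by (intro sum.cong) (auto simp: block_point_def block_dir_def)
  then show ?thesis by (simp only: sum_block[OF assms])
qed

lemma psum_block_point_1:
  assumes "1 \<le> M" "M \<le> n"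
  shows "psum n (block_point n M \<rho>) 1 = 1"
  unfolding psum_block_point[OF assms(2)] using assms by (simp add: field_simps)

text \<open>Bernoulli's inequality in each coordinate; the linear terms cancel because the direction
  sums to zero. This keeps the moments positive despite the negative mass.\<close>

lemma psum_vacuum_le:
  assumes M: "1 \<le> M" "M \<le> n" and \<rho>: "0 \<le> \<rho>" "\<rho> \<le> 1"
  shows "psum n (block_point n N 0) k \<le> psum n (block_point n M \<rho>) k"
proof -
  have "(\<Sum>i = 1..n. (1 + real k * (\<rho> * block_dir n M i)) / real n ^ k) \<le> psum n (block_point n M \<rho>) k"
    unfolding psum_def block_point_def power_divide
  proof (intro sum_mono divide_right_mono)
    fix i
    have "- 1 \<le> block_dir n M i" by (simp add: block_dir_def)
    then have "\<rho> * - 1 \<le> \<rho> * block_dir n M i" using \<rho> by (intro mult_left_mono) auto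
    then have "- 1 \<le> \<rho> * block_dir n M i" using \<rho> by simp
    then show "1 + real k * (\<rho> * block_dir n M i) \<le> (1 + \<rho> * block_dir n M i) ^ k"
      by (rule Bernoulli_inequality)
  qed simp
  moreover have "(\<Sum>i = 1..n. (1 + real k * (\<rho> * block_dir n M i)) / real n ^ k) =
      (real n + real k * (\<rho> * (\<Sum>i = 1..n. block_dir n M i))) / real n ^ k"
    by (simp add: sum.distrib flip: sum_divide_distrib sum_distrib_left)
  ultimately show ?thesis
    unfolding sum_block_dir(1)[OF M] by (simp add: psum_def block_point_def power_divide)
qed

lemma block_point_nonneg: "0 \<le> \<rho> \<Longrightarrow> \<rho> \<le> 1 \<Longrightarrow> 0 \<le> block_point n M \<rho> i"
  using order.trans[OF _ block_point_ge[of \<rho> n M i]] by simp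

lemma psum_nonneg: "(\<And>i. 0 \<le> y i) \<Longrightarrow> 0 \<le> psum n y k"
  by (simp add: psum_def sum_nonneg)

lemma psum_Suc_le_power:
  assumes y: "\<And>i. i \<in> {1..n} \<Longrightarrow> 0 \<le> y i" "\<And>i. i \<in> {1..n} \<Longrightarrow> y i \<le> c" and "psum n y 1 = 1"
  shows "psum n y (Suc k) \<le> c ^ k"
proof -
  have "psum n y (Suc k) \<le> (\<Sum>i = 1..n. y i * c ^ k)"
    unfolding psum_def power_Suc using y by (intro sum_mono mult_left_mono power_mono) auto
  also have "\<dots> = c ^ k * psum n y 1" by (simp add: psum_def sum_distrib_left mult.commute)
  finally show ?thesis using assms(3) by simp
qed

lemma psum_le_1:
  assumes y: "\<And>i. 0 \<le> y i" and "psum n y 1 = 1" "k \<ge> 1"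
  shows "psum n y k \<le> 1"
proof -
  have "y i \<le> 1" if "i \<in> {1..n}" for i
    using member_le_sum[of i "{1..n}" y] that y assms(2) by (simp add: psum_def)
  then have "psum n y (Suc (k - 1)) \<le> 1 ^ (k - 1)"
    using y assms(2) by (intro psum_Suc_le_power) auto
  then show ?thesis using assms(3) by simp
qed

text \<open>Nonnegativity is carried along because the inductive step multiplies
  inequalities.\<close>

lemma prod_mset_le:
  fixes f g :: "'a \<Rightarrow> real"
  shows "(\<And>r. r \<in># l \<Longrightarrow> 0 \<le> f r \<and> f r \<le> g r) \<Longrightarrow>
    0 \<le> (\<Prod>r \<in># l. f r) \<and> (\<Prod>r \<in># l. f r) \<le> (\<Prod>r \<in># l. g r)"
proof (induction l)
  case (add x l)
  have "0 \<le> f x" "f x \<le> g x" using add.prems[of x] by auto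
  moreover have "0 \<le> (\<Prod>r \<in># l. f r) \<and> (\<Prod>r \<in># l. f r) \<le> (\<Prod>r \<in># l. g r)"
    using add.prems by (intro add.IH) auto
  ultimately show ?case by (auto intro!: mult_mono)
qed simp

lemma psum_part_le:
  assumes "\<And>i. 0 \<le> y i" "\<And>k. psum n y k \<le> psum n y' k"
  shows "psum_part n y l \<le> psum_part n y' l"
  unfolding psum_part_def using assms by (intro prod_mset_le[THEN conjunct2]) (auto intro: psum_nonneg)

lemma psum_part_nonneg: "(\<And>i. 0 \<le> y i) \<Longrightarrow> 0 \<le> psum_part n y l"
  unfolding psum_part_def by (intro prod_mset_le[THEN conjunct1]) (auto intro: psum_nonneg)

lemma psum_part_le_1:
  assumes y: "\<And>i. 0 \<le> y i" and "psum n y 1 = 1" and l: "l \<in> even_partitions k"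
  shows "psum_part n y l \<le> 1"
proof -
  have "0 \<le> psum n y (r div 2) \<and> psum n y (r div 2) \<le> 1" if "r \<in># l" for r
  proof -
    have "0 < r" "even r" using l that by (auto simp: even_partitions_def)
    then have "1 \<le> r div 2" by presburger
    then show ?thesis using psum_le_1[OF y assms(2)] psum_nonneg[OF y] by simp
  qed
  from prod_mset_le[of l "\<lambda>r. psum n y (r div 2)" "\<lambda>_. 1", OF this]
  show ?thesis unfolding psum_part_def by simp
qed

lemma psum_part_ge_power:
  assumes l: "l \<in> even_partitions (2 * d)" and \<rho>: "\<rho> \<ge> 0" "\<And>k. \<rho> ^ k \<le> psum n y k"
  shows "\<rho> ^ d \<le> psum_part n y l"
proof -
  have ev: "\<forall>r \<in># l. even r" and sm: "sum_mset l = 2 * d"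
    using l by (auto simp: even_partitions_def)
  have "2 * (\<Sum>r \<in># l. r div 2) = sum_mset l" using ev by (induction l) auto
  then have "(\<Sum>r \<in># l. r div 2) = d" using sm by simp
  moreover have "(\<Prod>r \<in># l. \<rho> ^ (r div 2)) = \<rho> ^ (\<Sum>r \<in># l. r div 2)"
    by (induction l) (simp_all add: power_add)
  ultimately show ?thesis
    unfolding psum_part_def
    using prod_mset_le[of l "\<lambda>r. \<rho> ^ (r div 2)" "\<lambda>r. psum n y (r div 2)"] \<rho> by simp
qed

lemma block_point_power_le_psum:
  assumes "n \<ge> 1" "0 \<le> \<rho>" "\<rho> \<le> 1"
  shows "\<rho> ^ k \<le> psum n (block_point n 1 \<rho>) k"
proof -
  have "\<rho> \<le> block_point n 1 \<rho> 1"
    using assms by (simp add: block_point_def block_dir_def field_simps)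
  then have "\<rho> ^ k \<le> block_point n 1 \<rho> 1 ^ k"
    using assms by (intro power_mono)
  also have "\<dots> \<le> psum n (block_point n 1 \<rho>) k"
    unfolding psum_def using assms block_point_nonneg[OF assms(2,3)]
    by (intro member_le_sum[of 1 "{1..n}" "\<lambda>i. block_point n 1 \<rho> i ^ k"]) auto
  finally show ?thesis .
qed

section \<open>Bounds for all moments, which keep their logarithms in a bounded range\<close>

context
  fixes b d :: nat
  assumes b: "b \<ge> 2"
begin

private lemma t_bounds: "0 \<le> 1 / real b ^ 5" "1 / real b ^ 5 \<le> 1"
  using b by (auto simp: divide_le_eq_1)

private lemma node_bounds': "0 \<le> node j" "node j \<le> 1"
  using node_bounds[of j] by linarith+

private lemma M_le_n: "1 \<le> b ^ 8" "b ^ 8 \<le> b ^ 10" "1 \<le> b ^ 10"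
  using b by (auto intro: power_increasing)

private lemma vacuum_le:
  "psum_part (b ^ 10) (block_point (b ^ 10) 1 0) l \<le> psum_part (b ^ 10) (block_point (b ^ 10) 1 (1 / real b ^ 5)) l"
  by (intro psum_part_le block_point_nonneg psum_vacuum_le) (use t_bounds M_le_n in auto)

private lemma pp_bounds:
  assumes "l \<in> even_partitions (2 * d)" "M \<in> {1, b ^ 8}" "0 \<le> \<rho>" "\<rho> \<le> 1"
  shows "0 \<le> psum_part (b ^ 10) (block_point (b ^ 10) M \<rho>) l"
    and "psum_part (b ^ 10) (block_point (b ^ 10) M \<rho>) l \<le> 1"
proof -
  have "1 \<le> M" "M \<le> b ^ 10" using assms(2) M_le_n by auto
  then show "0 \<le> psum_part (b ^ 10) (block_point (b ^ 10) M \<rho>) l"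
    "psum_part (b ^ 10) (block_point (b ^ 10) M \<rho>) l \<le> 1"
    using assms by (auto intro!: psum_part_nonneg psum_part_le_1 block_point_nonneg psum_block_point_1)
qed

text \<open>The perturbed point outweighs the removed mass by \<open>psum_vacuum_le\<close>, and the
  other terms are nonnegative. The node one half alone supplies the bound, as one coordinate there
  is at least one half.\<close>

lemma pseudo_mean_psum_part_ge:
  assumes l: "l \<in> even_partitions (2 * d)"
  shows "(1 / 2) ^ d \<le> pseudo_mean d b (\<lambda>y. psum_part (b ^ 10) y l)"
proof -
  let ?f = "\<lambda>M \<rho>. psum_part (b ^ 10) (block_point (b ^ 10) M \<rho>) l"
  have "real b ^ 25 * ?f 1 0 \<le> real b ^ 25 * ?f 1 (1 / real b ^ 5)"
    by (intro mult_left_mono vacuum_le) simp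
  moreover have "0 \<le> real b ^ 24 * ?f 1 0"
    using pp_bounds(1)[OF l] by simp
  moreover have "0 \<le> real b ^ 24 * (\<Sum>j\<le>d. ?f (b ^ 8) (node j))"
    using pp_bounds(1)[OF l] node_bounds' by (intro mult_nonneg_nonneg sum_nonneg) auto
  moreover have "(1 / 2) ^ d \<le> (\<Sum>j\<le>d. ?f 1 (node j))"
  proof -
    have "(1 / 2) ^ d \<le> ?f 1 (node 0)"
      using M_le_n by (intro psum_part_ge_power[OF l]) (auto simp: node_def intro!: block_point_power_le_psum[of "b ^ 10" "1 / 2", simplified])
    also have "\<dots> \<le> (\<Sum>j\<le>d. ?f 1 (node j))"
      using pp_bounds(1)[OF l] node_bounds' by (intro member_le_sum) auto
    finally show ?thesis .
  qed
  ultimately show ?thesis unfolding pseudo_mean_def left_diff_distrib by linarith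
qed

lemma pseudo_mean_psum_part_le:
  assumes l: "l \<in> even_partitions (2 * d)" and bd: "b \<ge> 2 * d + 2"
  shows "pseudo_mean d b (\<lambda>y. psum_part (b ^ 10) y l) \<le> real b ^ 26"
proof -
  let ?f = "\<lambda>M \<rho>. psum_part (b ^ 10) (block_point (b ^ 10) M \<rho>) l"
  have h1: "real b ^ 25 * ?f 1 (1 / real b ^ 5) \<le> real b ^ 25 * 1"
    using pp_bounds(2)[OF l] t_bounds by (intro mult_left_mono) auto
  have h2: "0 \<le> (real b ^ 25 - real b ^ 24) * ?f 1 0"
    using pp_bounds(1)[OF l] b by (intro mult_nonneg_nonneg) auto
  have h3: "real b ^ 24 * (\<Sum>j\<le>d. ?f (b ^ 8) (node j)) \<le> real b ^ 24 * (\<Sum>j\<le>d. 1)"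
    using pp_bounds(2)[OF l] node_bounds' by (intro mult_left_mono sum_mono) auto
  have h4: "(\<Sum>j\<le>d. ?f 1 (node j)) \<le> (\<Sum>j\<le>d. 1)"
    using pp_bounds(2)[OF l] node_bounds' by (intro sum_mono) auto
  have "w - x + y + z \<le> w' + y' + z'" if "w \<le> w'" "0 \<le> x" "y \<le> y'" "z \<le> z'"
    for w x y z w' y' z' :: real
    using that by linarith
  from this[OF h1 h2 h3 h4] have "pseudo_mean d b (\<lambda>y. psum_part (b ^ 10) y l) \<le>
      real b ^ 25 + real b ^ 24 * (real d + 1) + (real d + 1)"
    unfolding pseudo_mean_def by (simp add: add.commute)
  also have "\<dots> \<le> real b ^ 25 + real b ^ 24 * (real d + 1) + real b ^ 24 * (real d + 1)"
    using b by simp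
  also have "\<dots> = real b ^ 25 + real b ^ 24 * (2 * real d + 2)" by (simp add: algebra_simps)
  also have "\<dots> \<le> real b ^ 25 + real b ^ 24 * real b"
    using bd by (intro add_left_mono mult_left_mono) auto
  also have "\<dots> = 2 * real b ^ 25" using power_Suc2[of "real b" 24] by simp
  also have "\<dots> \<le> real b * real b ^ 25" using b by (intro mult_right_mono) auto
  also have "\<dots> = real b ^ 26" using power_Suc[of "real b" 25] by simp
  finally show ?thesis .
qed

end

section \<open>The three partitions in the separating inequality and their moments\<close>

definition part_ones :: "nat \<Rightarrow> nat multiset"
  where "part_ones d = replicate_mset d 2"

text \<open>Parts are doubled: \<open>6\<close>, \<open>4\<close> and \<open>2\<close> stand for the
  power sums of index \<open>3\<close>, \<open>2\<close> and \<open>1\<close> in the squared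
  coordinates.\<close>

definition part_three :: "nat \<Rightarrow> nat multiset"
  where "part_three d = add_mset 6 (replicate_mset (d - 3) 2)"

definition part_three_two :: "nat \<Rightarrow> nat multiset"
  where "part_three_two d = add_mset 6 (add_mset 4 (replicate_mset (d - 5) 2))"

lemma parts_in_even_partitions:
  assumes "d \<ge> 5"
  shows "part_ones d \<in> even_partitions (2 * d)" "part_three d \<in> even_partitions (2 * d)"
    "part_three_two d \<in> even_partitions (2 * d)"
  using assms by (auto simp: even_partitions_def part_ones_def part_three_def part_three_two_def
      sum_mset_replicate_mset split: if_splits)

lemma parts_distinct:
  assumes "d \<ge> 5"
  shows "part_ones d \<noteq> part_three d" "part_ones d \<noteq> part_three_two d" "part_three d \<noteq> part_three_two d"
proof -
  have "size (part_ones d) = d" "size (part_three d) = d - 2" "size (part_three_two d) = d - 3"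
    using assms by (auto simp: part_ones_def part_three_def part_three_two_def)
  then show "part_ones d \<noteq> part_three d" "part_ones d \<noteq> part_three_two d" "part_three d \<noteq> part_three_two d"
    using assms by auto
qed

lemma psum_part_parts:
  "psum_part n y (part_ones d) = psum n y 1 ^ d"
  "psum_part n y (part_three d) = psum n y 3 * psum n y 1 ^ (d - 3)"
  "psum_part n y (part_three_two d) = psum n y 3 * psum n y 2 * psum n y 1 ^ (d - 5)"
  by (simp_all add: psum_part_def part_ones_def part_three_def part_three_two_def)

text \<open>All points have first power sum \<open>1\<close>, so the first moment is the total mass.
  The orders \<open>24\<close>, \<open>10\<close> and \<open>0\<close> in \<open>b\<close> are
  arranged so that \<open>5 * 10 > 2 * 24 + 3 * 0\<close>.\<close>

lemma pseudo_mean_values: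
  assumes b: "b \<ge> 2"
  shows "pseudo_mean d b (\<lambda>y. psum_part (b ^ 10) y (part_ones d)) \<le> (2 * real d + 3) * real b ^ 24"
    and "real b ^ 10 / 2 \<le> pseudo_mean d b (\<lambda>y. psum_part (b ^ 10) y (part_three d))"
    and "pseudo_mean d b (\<lambda>y. psum_part (b ^ 10) y (part_three_two d)) \<le> 9 * real d + 54"
proof -
  define n where "n = b ^ 10"
  define M where "M = b ^ 8"
  define t where "t = 1 / real b ^ 5"
  have n: "n \<ge> 1" and M: "M \<ge> 1" "M \<le> n"
    using b by (auto simp: n_def M_def intro: power_increasing)
  have nn: "1 / real n = t\<^sup>2" by (simp add: n_def t_def power_divide flip: power_mult)
  have t: "0 < t" "t \<le> 1" using b by (auto simp: t_def divide_le_eq_1)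
  have p1: "psum n (block_point n N \<rho>) 1 = 1" if "N = 1 \<or> N = M" for N \<rho>
    using that n M psum_block_point_1[of 1 n \<rho>] psum_block_point_1[of M n \<rho>] by auto
  have nonneg: "0 \<le> psum n (block_point n N \<rho>) k" if "0 \<le> \<rho>" "\<rho> \<le> 1" for N \<rho> k
    using that by (intro psum_nonneg block_point_nonneg)
  have le1: "psum n (block_point n N \<rho>) k \<le> 1" if "0 \<le> \<rho>" "\<rho> \<le> 1" "N = 1 \<or> N = M" "k \<ge> 1" for N \<rho> k
    using that by (intro psum_le_1 block_point_nonneg p1) auto
  have nd: "0 \<le> node j" "node j \<le> 1" for j using node_bounds[of j] by linarith+
  have pm: "pseudo_mean d b h = real b ^ 25 * h (block_point n 1 t) - (real b ^ 25 - real b ^ 24) * h (block_point n 1 0)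
      + real b ^ 24 * (\<Sum>j\<le>d. h (block_point n M (node j))) + (\<Sum>j\<le>d. h (block_point n 1 (node j)))" for h
    by (simp add: pseudo_mean_def n_def M_def t_def)
  have bt: "real b ^ 25 * t ^ 3 = real b ^ 10" "real b ^ 25 * t ^ 4 = real b ^ 5" "real b ^ 25 * t ^ 5 = 1"
    using b by (simp_all add: t_def power_divide field_simps flip: power_mult power_add)

  have "pseudo_mean d b (\<lambda>y. psum_part n y (part_ones d)) =
      real b ^ 24 + real b ^ 24 * (real d + 1) + (real d + 1)"
    unfolding pm psum_part_parts by (simp add: p1[simplified] algebra_simps)
  also have "\<dots> \<le> real b ^ 24 + real b ^ 24 * (real d + 1) + real b ^ 24 * (real d + 1)"
    using b by simp
  also have "\<dots> = (2 * real d + 3) * real b ^ 24" by (simp add: algebra_simps)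
  finally show "pseudo_mean d b (\<lambda>y. psum_part (b ^ 10) y (part_ones d)) \<le> (2 * real d + 3) * real b ^ 24"
    unfolding n_def .

  have f3: "psum_part n (block_point n N \<rho>) (part_three d) = psum n (block_point n N \<rho>) 3"
    if "N = 1 \<or> N = M" for N \<rho>
    unfolding psum_part_parts p1[OF that] by simp
  have v3: "psum n (block_point n 1 0) 3 = t ^ 4"
  proof -
    have "psum n (block_point n 1 0) 3 = (1 / real n)\<^sup>2"
      using n by (simp add: psum_def block_point_def power2_eq_square power3_eq_cube)
    then show ?thesis unfolding nn by (simp flip: power_mult)
  qed
  \<comment> \<open>The perturbed point contributes at least \<open>b ^ 10\<close>, and the full
    vacuum mass would take away only \<open>b ^ 5\<close>, at most half of that.\<close>
  have "real b ^ 5 * 2 \<le> real b ^ 5 * real b ^ 5"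
  proof (rule mult_left_mono)
    have "real b ^ 1 \<le> real b ^ 5" by (rule power_increasing) (use b in auto)
    then show "2 \<le> real b ^ 5" using b unfolding power_one_right by linarith
  qed simp
  then have "2 * real b ^ 5 \<le> real b ^ 10" by (simp flip: power_add)
  moreover have "real b ^ 10 \<le> real b ^ 25 * psum n (block_point n 1 t) 3"
    unfolding bt(1)[symmetric] using t n by (intro mult_left_mono block_point_power_le_psum) auto
  moreover have "real b ^ 25 * psum n (block_point n 1 0) 3 = real b ^ 5"
    unfolding v3 by (rule bt(2))
  moreover have "0 \<le> real b ^ 24 * psum n (block_point n 1 0) 3" by (simp add: nonneg)
  moreover have "0 \<le> real b ^ 24 * (\<Sum>j\<le>d. psum n (block_point n M (node j)) 3)"
    "0 \<le> (\<Sum>j\<le>d. psum n (block_point n 1 (node j)) 3)"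
    by (auto intro!: mult_nonneg_nonneg sum_nonneg nonneg nd)
  ultimately have "real b ^ 10 / 2 \<le> pseudo_mean d b (\<lambda>y. psum_part n y (part_three d))"
    unfolding pm left_diff_distrib by (simp only: f3 simp_thms)
  then show "real b ^ 10 / 2 \<le> pseudo_mean d b (\<lambda>y. psum_part (b ^ 10) y (part_three d))"
    unfolding n_def .

  have f32: "psum_part n (block_point n N \<rho>) (part_three_two d) = psum n (block_point n N \<rho>) 3 * psum n (block_point n N \<rho>) 2"
    if "N = 1 \<or> N = M" for N \<rho>
    unfolding psum_part_parts p1[OF that] by simp
  \<comment> \<open>As \<open>1 / n = t\<^sup>2\<close>, the raised coordinate is at most
    \<open>2 * t\<close>, while the others are at most \<open>1 / n\<close>.\<close>
  have single: "psum n (block_point n 1 t) k \<le> (2 * t) ^ k + real n * (1 / real n) ^ k" for k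
  proof -
    have "(1 + t * (real n / real 1 - 1)) / real n \<le> t + 1 / real n"
      using n t by (simp add: field_simps)
    also have "\<dots> \<le> 2 * t" unfolding nn using t by (simp add: power2_eq_square mult_left_le)
    finally have "((1 + t * (real n / real 1 - 1)) / real n) ^ k \<le> (2 * t) ^ k"
      using n t by (intro power_mono) auto
    moreover have "(real n - 1) * ((1 - t) / real n) ^ k \<le> real n * (1 / real n) ^ k"
      using n t by (intro mult_mono power_mono divide_right_mono) auto
    ultimately show ?thesis unfolding psum_block_point[OF n] by simp
  qed
  have n1: "real n * t\<^sup>2 = 1" using n by (simp flip: nn)
  have "psum n (block_point n 1 t) 2 \<le> 5 * t ^ 2"
  proof -
    have "real n * (1 / real n)\<^sup>2 = 1 / real n" using n by (simp add: power2_eq_square)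
    then have "real n * (1 / real n)\<^sup>2 = t\<^sup>2" unfolding nn .
    then show ?thesis using single[of 2] by (simp add: power_mult_distrib)
  qed
  moreover have "psum n (block_point n 1 t) 3 \<le> 9 * t ^ 3"
  proof -
    have "real n * (1 / real n) ^ 3 = (real n * t\<^sup>2) * t ^ 4" unfolding nn by (simp flip: power_mult power_add)
    also have "\<dots> \<le> t ^ 3" unfolding n1 using t power_decreasing[of 3 4 t] by simp
    finally show ?thesis using single[of 3] by (simp add: power_mult_distrib)
  qed
  ultimately have "psum n (block_point n 1 t) 3 * psum n (block_point n 1 t) 2 \<le> 9 * t ^ 3 * (5 * t ^ 2)"
    using t by (intro mult_mono nonneg) auto
  also have "\<dots> = 45 * t ^ 5" by (simp flip: power_add)
  finally have "real b ^ 25 * (psum n (block_point n 1 t) 3 * psum n (block_point n 1 t) 2) \<le> real b ^ 25 * (45 * t ^ 5)"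
    by (intro mult_left_mono) auto
  also have "\<dots> = 45" using bt(3) by simp
  finally have i1: "real b ^ 25 * (psum n (block_point n 1 t) 3 * psum n (block_point n 1 t) 2) \<le> 45" .
  have "0 \<le> (real b ^ 25 - real b ^ 24) * (psum n (block_point n 1 0) 3 * psum n (block_point n 1 0) 2)"
    using b by (intro mult_nonneg_nonneg nonneg) auto
  \<comment> \<open>On the wide blocks every coordinate is at most \<open>2 / M\<close>, so the
    product is at most \<open>(2 / M) ^ 3 = 8 / b ^ 24\<close>, which offsets the mass.\<close>
  moreover have "real b ^ 24 * (\<Sum>j\<le>d. psum n (block_point n M (node j)) 3 * psum n (block_point n M (node j)) 2) \<le> 8 * (real d + 1)"
  proof -
    have "psum n (block_point n M (node j)) 3 * psum n (block_point n M (node j)) 2 \<le> 8 / real b ^ 24" for j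
    proof -
      have "block_point n M (node j) i \<le> 2 / real M" for i
      proof -
        have "block_dir n M i \<le> real n / real M"
          by (auto simp: block_dir_def intro: order.trans[of _ 0])
        then have "node j * block_dir n M i \<le> node j * (real n / real M)"
          using nd by (intro mult_left_mono)
        also have "\<dots> \<le> 1 * (real n / real M)"
          using nd by (intro mult_right_mono) auto
        finally have "node j * block_dir n M i \<le> real n / real M" by simp
        then have "block_point n M (node j) i \<le> (1 + real n / real M) / real n"
          unfolding block_point_def by (intro divide_right_mono) auto
        also have "\<dots> = 1 / real n + 1 / real M" using n by (simp add: field_simps)
        also have "\<dots> \<le> 1 / real M + 1 / real M"
          using M by (intro add_right_mono divide_left_mono) auto
        finally show ?thesis by simp
      qed
      then have "psum n (block_point n M (node j)) (Suc k) \<le> (2 / real M) ^ k" for k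
        by (intro psum_Suc_le_power block_point_nonneg nd p1) auto
      from mult_mono[OF this[of 2] this[of 1]]
      have "psum n (block_point n M (node j)) 3 * psum n (block_point n M (node j)) 2 \<le> (2 / real M)\<^sup>2 * (2 / real M)"
        using nonneg nd by (simp add: numeral_3_eq_3 numeral_2_eq_2)
      also have "\<dots> = 8 / real b ^ 24" by (simp add: M_def power2_eq_square flip: power_add)
      finally show ?thesis .
    qed
    then have "real b ^ 24 * (\<Sum>j\<le>d. psum n (block_point n M (node j)) 3 * psum n (block_point n M (node j)) 2) \<le>
        real b ^ 24 * (\<Sum>j\<le>d. 8 / real b ^ 24)"
      by (intro mult_left_mono sum_mono) auto
    also have "\<dots> = 8 * (real d + 1)" using b by simp
    finally show ?thesis .
  qed
  moreover have "(\<Sum>j\<le>d. psum n (block_point n 1 (node j)) 3 * psum n (block_point n 1 (node j)) 2) \<le> (\<Sum>j\<le>d. 1)"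
    by (intro sum_mono mult_le_one le1 nonneg nd) auto
  ultimately have "pseudo_mean d b (\<lambda>y. psum_part n y (part_three_two d)) \<le> 45 + 8 * (real d + 1) + (real d + 1)"
    unfolding pm using i1 by (simp only: f32 simp_thms) simp
  then show "pseudo_mean d b (\<lambda>y. psum_part (b ^ 10) y (part_three_two d)) \<le> 9 * real d + 54"
    unfolding n_def by simp
qed

section \<open>The separating inequality on nonnegative points\<close>

lemma psum_3_2: "(psum n y 3)\<^sup>2 \<le> psum n y 2 ^ 3" if y: "\<And>i. 0 \<le> y i"
proof -
  have "(psum n y 3)\<^sup>2 = (\<Sum>i = 1..n. y i * (y i)\<^sup>2)\<^sup>2"
    by (simp add: psum_def power3_eq_cube power2_eq_square mult.assoc)
  \<comment> \<open>Cauchy-Schwarz leaves the fourth power sum, which is at most the square of the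
    second.\<close>
  also have "\<dots> \<le> psum n y 2 * (\<Sum>i = 1..n. ((y i)\<^sup>2)\<^sup>2)"
    unfolding psum_def by (rule Cauchy_Schwarz_ineq_sum)
  also have "(\<Sum>i = 1..n. ((y i)\<^sup>2)\<^sup>2) \<le> (\<Sum>i = 1..n. (y i)\<^sup>2 * psum n y 2)"
    unfolding psum_def power2_eq_square[of "(y _)\<^sup>2"]
    by (intro sum_mono mult_left_mono member_le_sum) auto
  also have "\<dots> = (psum n y 2)\<^sup>2"
    by (simp add: psum_def power2_eq_square sum_distrib_right)
  finally show ?thesis
    by (simp add: psum_nonneg[OF y] mult_left_mono power2_eq_square power3_eq_cube mult.assoc)
qed

text \<open>Weighted AM-GM for fifth powers. The difference has a double root at
  \<open>a = b\<close>, and the cofactor has nonnegative coefficients.\<close>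

lemma young_2_3: "5 * (a\<^sup>2 * b ^ 3) \<le> 2 * a ^ 5 + 3 * b ^ 5" if "a \<ge> 0" "b \<ge> 0" for a b :: real
proof -
  have "2 * a ^ 5 + 3 * b ^ 5 - 5 * (a\<^sup>2 * b ^ 3) = (a - b)\<^sup>2 * (2 * a ^ 3 + 4 * a\<^sup>2 * b + 6 * a * b\<^sup>2 + 3 * b ^ 3)"
    by algebra
  moreover have "\<dots> \<ge> 0" using that by (intro mult_nonneg_nonneg add_nonneg_nonneg) auto
  ultimately show ?thesis by linarith
qed

text \<open>Only inequalities linear in the products of power sums define elements of the cone, so
  the multiplicative one is replaced by a family in the scale \<open>s\<close>.
  \<open>young_2_3\<close> is applied to \<open>s ^ 3 * p 1\<close> and \<open>z / s\<^sup>2\<close>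
  with \<open>z\<close> the cube root of \<open>p 3\<close>; the scale cancels on its left side, and
  \<open>z ^ 5 \<le> p 3 * p 2\<close> follows from \<open>psum_3_2\<close>.\<close>

lemma psum_parts_inequality:
  assumes d: "d \<ge> 5" and s: "s > 0" and y: "\<And>i. 0 \<le> y i"
  shows "5 * psum_part n y (part_three d) \<le>
    2 * s ^ 15 * psum_part n y (part_ones d) + 3 / s ^ 10 * psum_part n y (part_three_two d)"
proof -
  define p where "p k = psum n y k" for k
  have p0: "p k \<ge> 0" for k unfolding p_def by (rule psum_nonneg[OF y])
  define z where "z = root 3 (p 3)"
  have z: "z \<ge> 0" "z ^ 3 = p 3" using p0 by (auto simp: z_def)
  have "(z\<^sup>2) ^ 3 = (p 3)\<^sup>2" unfolding z(2)[symmetric] by (simp flip: power_mult)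
  also have "\<dots> \<le> p 2 ^ 3" unfolding p_def by (rule psum_3_2[OF y])
  finally have "z\<^sup>2 \<le> p 2"
    using power_mono_iff[of "z\<^sup>2" "p 2" 3] p0[of 2] by (metis zero_le_power2 zero_less_numeral)
  then have "z ^ 3 * z\<^sup>2 \<le> p 3 * p 2" unfolding z(2) using p0 by (intro mult_left_mono)
  then have z5: "z ^ 5 \<le> p 3 * p 2" by (simp flip: power_add)
  have "5 * (p 1 ^ 2 * p 3) = 5 * ((s ^ 3 * p 1)\<^sup>2 * (z / s\<^sup>2) ^ 3)"
    using s by (simp add: z power_mult_distrib power_divide flip: power_mult)
  also have "\<dots> \<le> 2 * (s ^ 3 * p 1) ^ 5 + 3 * (z / s\<^sup>2) ^ 5"
    using s z p0 by (intro young_2_3) auto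
  also have "\<dots> = 2 * s ^ 15 * p 1 ^ 5 + 3 / s ^ 10 * z ^ 5"
    by (simp add: power_mult_distrib power_divide flip: power_mult)
  also have "\<dots> \<le> 2 * s ^ 15 * p 1 ^ 5 + 3 / s ^ 10 * (p 3 * p 2)"
    using s z5 by (intro add_left_mono mult_left_mono) auto
  finally have "p 1 ^ (d - 5) * (5 * (p 1 ^ 2 * p 3)) \<le>
      p 1 ^ (d - 5) * (2 * s ^ 15 * p 1 ^ 5 + 3 / s ^ 10 * (p 3 * p 2))"
    using p0 by (intro mult_left_mono) auto
  moreover have "p 1 ^ (d - 5) * p 1 ^ 2 = p 1 ^ (d - 3)" "p 1 ^ (d - 5) * p 1 ^ 5 = p 1 ^ d"
  proof -
    have "d - 3 = (d - 5) + 2" "d = (d - 5) + 5" using d by auto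
    then show "p 1 ^ (d - 5) * p 1 ^ 2 = p 1 ^ (d - 3)" "p 1 ^ (d - 5) * p 1 ^ 5 = p 1 ^ d"
      by (metis power_add)+
  qed
  ultimately show ?thesis
    unfolding psum_part_parts p_def[symmetric] by (simp add: algebra_simps)
qed

subsection \<open>The tropicalizations\<close>

text \<open>Bolzano-Weierstrass in one coordinate after another, thinning the subsequence each
  time.\<close>

lemma convergent_subsequence_finite:
  fixes f :: "nat \<Rightarrow> 'i \<Rightarrow> real"
  assumes "finite I" "\<And>m i. i \<in> I \<Longrightarrow> \<bar>f m i\<bar> \<le> C"
  shows "\<exists>r y. strict_mono (r :: nat \<Rightarrow> nat) \<and> (\<forall>i \<in> I. (\<lambda>m. f (r m) i) \<longlonglongrightarrow> y i)"
  using assms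
proof (induction I rule: finite_induct)
  case empty
  then show ?case by (auto intro: exI[of _ id] strict_mono_id)
next
  case (insert i I)
  have "\<exists>r y. strict_mono (r :: nat \<Rightarrow> nat) \<and> (\<forall>j \<in> I. (\<lambda>m. f (r m) j) \<longlonglongrightarrow> y j)"
    using insert.prems by (intro insert.IH) auto
  then obtain r y where r: "strict_mono r" "\<forall>j \<in> I. (\<lambda>m. f (r m) j) \<longlonglongrightarrow> y j"
    by blast
  have "f (r m) i \<in> {- C..C}" for m
    using insert.prems[of i "r m"] by (auto simp: abs_le_iff)
  then obtain l s where s: "strict_mono s" "((\<lambda>m. f (r m) i) \<circ> s) \<longlonglongrightarrow> l"
    using compact_imp_seq_compact[OF compact_Icc, of "- C" C] by (metis seq_compactE)
  have "(\<lambda>m. f ((r \<circ> s) m) j) \<longlonglongrightarrow> (y(i := l)) j" if "j \<in> insert i I" for j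
  proof (cases "j = i")
    case True
    then show ?thesis using s(2) by (simp add: o_def)
  next
    case False
    then show ?thesis
      using LIMSEQ_subseq_LIMSEQ[OF r(2)[rule_format, of j] s(1)] that by (simp add: o_def)
  qed
  then show ?case using strict_mono_o[OF r(1) s(1)] by blast
qed

text \<open>Pairing the functional with the member of the family
  \<open>psum_parts_inequality\<close> at the best scale recovers the multiplicative
  inequality.\<close>

lemma dual_BP_inequality:
  assumes d: "d \<ge> 5" and x: "x \<in> dual_cone (even_partitions (2 * d)) (BP (2 * d))"
    and pos: "\<And>l. l \<in> even_partitions (2 * d) \<Longrightarrow> 0 < x l"
  shows "x (part_three d) ^ 5 \<le> x (part_ones d) ^ 2 * x (part_three_two d) ^ 3"
proof -
  let ?I = "even_partitions (2 * d)"
  note parts = parts_in_even_partitions[OF d] and dist = parts_distinct[OF d]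
  define x1 where "x1 = x (part_ones d)"
  define x3 where "x3 = x (part_three d)"
  define x32 where "x32 = x (part_three_two d)"
  have xpos: "x1 > 0" "x3 > 0" "x32 > 0" using pos parts by (auto simp: x1_def x3_def x32_def)
  \<comment> \<open>This scale makes \<open>x32 / s ^ 10\<close> equal to
    \<open>s ^ 15 * x1\<close>, which minimises the right side of the paired inequality.\<close>
  define s where "s = root 25 (x32 / x1)"
  have s: "s > 0" "s ^ 25 = x32 / x1" using xpos by (auto simp: s_def)
  define c where "c = restrict (\<lambda>l. if l = part_ones d then 2 * s ^ 15 else
    if l = part_three d then - 5 else if l = part_three_two d then 3 / s ^ 10 else 0) ?I"
  have sum_c: "(\<Sum>l \<in> ?I. c l * g l) =
      2 * s ^ 15 * g (part_ones d) - 5 * g (part_three d) + 3 / s ^ 10 * g (part_three_two d)" for g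
  proof -
    have "(\<Sum>l \<in> ?I. c l * g l) = (\<Sum>l \<in> {part_ones d, part_three d, part_three_two d}. c l * g l)"
      using parts finite_even_partitions by (intro sum.mono_neutral_right) (auto simp: c_def)
    then show ?thesis using dist parts by (simp add: c_def)
  qed
  have "c \<in> BP (2 * d)"
  proof -
    have "0 \<le> meval z (ps_form (2 * d) n c)" for n z
      unfolding meval_ps_form_eq_psum_part sum_c
      using psum_parts_inequality[OF d s(1), of "\<lambda>i. (z i)\<^sup>2" n] by simp
    then show ?thesis by (auto simp: BP_def is_nonneg_def c_def)
  qed
  then have "0 \<le> (\<Sum>l \<in> ?I. c l * x l)" using x by (auto simp: dual_cone_def)
  then have "5 * x3 \<le> 2 * s ^ 15 * x1 + 3 / s ^ 10 * x32"
    unfolding sum_c x1_def x3_def x32_def by simp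
  moreover have "3 / s ^ 10 * x32 = 3 * s ^ 15 * x1"
  proof -
    have x32: "x32 = s ^ 10 * s ^ 15 * x1"
      using s(2) xpos by (simp add: field_simps flip: power_add)
    have "3 / u * (u * v * w) = 3 * v * w" if "u \<noteq> 0" for u v w :: real
      using that by simp
    then show ?thesis unfolding x32 using s(1) by (metis less_irrefl power_eq_0_iff)
  qed
  ultimately have "x3 \<le> s ^ 15 * x1" by (simp add: mult.commute)
  then have "x3 ^ 5 \<le> (s ^ 15 * x1) ^ 5" using xpos by (intro power_mono) auto
  also have "\<dots> = (s ^ 25) ^ 3 * x1 ^ 5" by (simp add: power_mult_distrib flip: power_mult)
  also have "\<dots> = x1 ^ 2 * x32 ^ 3"
    unfolding s(2) using xpos by (simp add: power_divide field_simps flip: power_add)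
  finally show ?thesis by (simp add: x1_def x3_def x32_def)
qed

text \<open>Logarithms make \<open>dual_BP_inequality\<close> linear, and a weak linear inequality
  survives the limit.\<close>

lemma trop_dual_BP_inequality:
  assumes d: "d \<ge> 5" and y: "y \<in> trop (even_partitions (2 * d)) (dual_cone (even_partitions (2 * d)) (BP (2 * d)))"
  shows "5 * y (part_three d) \<le> 2 * y (part_ones d) + 3 * y (part_three_two d)"
proof -
  let ?I = "even_partitions (2 * d)"
  note parts = parts_in_even_partitions[OF d]
  obtain x \<tau> where x\<tau>: "\<forall>m. x m \<in> dual_cone ?I (BP (2 * d)) \<and> (\<forall>l \<in> ?I. 0 < x m l)"
    "\<forall>m. 0 < \<tau> m \<and> \<tau> m < 1" "\<forall>l \<in> ?I. (\<lambda>m. log (1 / \<tau> m) (x m l)) \<longlonglongrightarrow> y l"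
    using y unfolding trop_def by blast
  then have x: "\<And>m. x m \<in> dual_cone ?I (BP (2 * d))" "\<And>m l. l \<in> ?I \<Longrightarrow> 0 < x m l"
    and \<tau>: "\<And>m. 0 < \<tau> m" "\<And>m. \<tau> m < 1"
    and lim: "\<And>l. l \<in> ?I \<Longrightarrow> (\<lambda>m. log (1 / \<tau> m) (x m l)) \<longlonglongrightarrow> y l"
    by blast+
  show ?thesis
  proof (rule LIMSEQ_le)
    show "(\<lambda>m. 5 * log (1 / \<tau> m) (x m (part_three d))) \<longlonglongrightarrow> 5 * y (part_three d)"
      by (intro tendsto_intros lim parts)
    show "(\<lambda>m. 2 * log (1 / \<tau> m) (x m (part_ones d)) + 3 * log (1 / \<tau> m) (x m (part_three_two d)))
        \<longlonglongrightarrow> 2 * y (part_ones d) + 3 * y (part_three_two d)"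
      by (intro tendsto_intros lim parts)
    show "\<exists>N. \<forall>m\<ge>N. 5 * log (1 / \<tau> m) (x m (part_three d)) \<le>
        2 * log (1 / \<tau> m) (x m (part_ones d)) + 3 * log (1 / \<tau> m) (x m (part_three_two d))"
    proof (intro exI allI impI)
      fix m
      have \<tau>1: "1 < 1 / \<tau> m" using \<tau> by (simp add: less_divide_eq)
      have pos: "0 < x m (part_ones d)" "0 < x m (part_three d)" "0 < x m (part_three_two d)"
        using x(2) parts by auto
      have "log (1 / \<tau> m) (x m (part_three d) ^ 5) \<le>
          log (1 / \<tau> m) (x m (part_ones d) ^ 2 * x m (part_three_two d) ^ 3)"
        using dual_BP_inequality[OF d x(1) x(2)] \<tau>1 pos by (intro log_mono) auto
      then show "5 * log (1 / \<tau> m) (x m (part_three d)) \<le>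
        2 * log (1 / \<tau> m) (x m (part_ones d)) + 3 * log (1 / \<tau> m) (x m (part_three_two d))"
        using pos by (simp add: log_mult log_nat_power)
    qed
  qed
qed

text \<open>The moments have bounded logarithms to base \<open>b\<close>, so a subsequence converges
  in all coordinates. The orders compare \<open>50\<close> with \<open>48\<close>: one spare factor
  \<open>b\<close> absorbs the constants, the other survives as a gap of \<open>1\<close> in the
  limit.\<close>

lemma trop_dual_BSigma_witness:
  assumes d: "d \<ge> 5"
  shows "\<exists>y \<in> trop (even_partitions (2 * d)) (dual_cone (even_partitions (2 * d)) (BSigma (2 * d))).
    2 * y (part_ones d) + 3 * y (part_three_two d) < 5 * y (part_three d)"
proof -
  let ?I = "even_partitions (2 * d)"
  note parts = parts_in_even_partitions[OF d]
  define X where "X b l = pseudo_mean d b (\<lambda>y. psum_part (b ^ 10) y l)" for b l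
  obtain B where B: "\<And>b c. b \<ge> B \<Longrightarrow> c \<in> BSigma (2 * d) \<Longrightarrow> 0 \<le> (\<Sum>l \<in> ?I. c l * X b l)"
    unfolding X_def using pseudo_mean_dual[of d] by blast
  \<comment> \<open>The last summand dominates the constants of \<open>pseudo_mean_values\<close>;
    \<open>32 = 2 ^ 5\<close> comes from the lower bound \<open>b ^ 10 / 2\<close>.\<close>
  define N where "N = B + (2 * d + 2) + 32 * (2 * d + 3) ^ 2 * (9 * d + 54) ^ 3"
  define b where "b m = m + N" for m
  have bN: "b m \<ge> B" "b m \<ge> 2 * d + 2" "b m \<ge> 2" "b m \<ge> 32 * (2 * d + 3) ^ 2 * (9 * d + 54) ^ 3" for m
    by (auto simp: b_def N_def)
  have b1: "1 < real (b m)" for m using bN(3)[of m] by simp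
  have ge: "(1 / 2) ^ d \<le> X (b m) l" and le: "X (b m) l \<le> real (b m) ^ 26" if "l \<in> ?I" for m l
    using that bN pseudo_mean_psum_part_ge pseudo_mean_psum_part_le by (auto simp: X_def)
  have pos: "0 < X (b m) l" if "l \<in> ?I" for m l
    using ge[OF that, of m] by (rule less_le_trans[rotated]) simp
  define L where "L m l = log (real (b m)) (X (b m) l)" for m l
  have bound: "\<bar>L m l\<bar> \<le> real d + 26" if l: "l \<in> ?I" for m l
  proof -
    have "real (b m) powr - real d = (1 / real (b m)) ^ d"
      using b1[of m] by (simp add: powr_minus powr_realpow power_inverse divide_inverse)
    also have "\<dots> \<le> (1 / 2) ^ d"
      using bN(3)[of m] by (intro power_mono divide_left_mono) auto
    also have "\<dots> \<le> X (b m) l" by (rule ge[OF l])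
    finally have "- real d \<le> L m l"
      unfolding L_def using b1 pos[OF l] by (simp add: le_log_iff)
    moreover have "X (b m) l \<le> real (b m) powr 26"
      using le[OF l, of m] b1[of m] by simp
    then have "L m l \<le> 26"
      unfolding L_def using b1 pos[OF l] by (simp add: log_le_iff)
    ultimately show ?thesis by simp
  qed
  obtain r y where r: "strict_mono (r :: nat \<Rightarrow> nat)" and y: "\<And>l. l \<in> ?I \<Longrightarrow> (\<lambda>m. L (r m) l) \<longlonglongrightarrow> y l"
    using convergent_subsequence_finite[where f = L and I = ?I, OF finite_even_partitions bound] by blast
  have key: "1 + (2 * L m (part_ones d) + 3 * L m (part_three_two d)) \<le> 5 * L m (part_three d)" for m
  proof -
    define x1 where "x1 = X (b m) (part_ones d)"
    define x3 where "x3 = X (b m) (part_three d)"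
    define x32 where "x32 = X (b m) (part_three_two d)"
    define \<beta> where "\<beta> = real (b m)"
    have xpos: "0 < x1" "0 < x3" "0 < x32" using pos parts by (auto simp: x1_def x3_def x32_def)
    have \<beta>: "\<beta> > 1" using b1 by (simp add: \<beta>_def)
    have vals: "x1 \<le> (2 * real d + 3) * \<beta> ^ 24" "\<beta> ^ 10 / 2 \<le> x3" "x32 \<le> 9 * real d + 54"
      using pseudo_mean_values[OF bN(3)[of m], of d] by (simp_all add: x1_def x3_def x32_def X_def \<beta>_def)
    have "real (32 * (2 * d + 3) ^ 2 * (9 * d + 54) ^ 3) \<le> \<beta>"
      unfolding \<beta>_def using bN(4)[of m] by (simp only: of_nat_le_iff)
    then have big: "32 * (2 * real d + 3) ^ 2 * (9 * real d + 54) ^ 3 \<le> \<beta>" by simp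
    have "\<beta> * (x1 ^ 2 * x32 ^ 3) \<le> \<beta> * (((2 * real d + 3) * \<beta> ^ 24) ^ 2 * (9 * real d + 54) ^ 3)"
      using \<beta> vals xpos by (intro mult_left_mono mult_mono power_mono) auto
    also have "\<dots> = \<beta> ^ 49 / 32 * (32 * (2 * real d + 3) ^ 2 * (9 * real d + 54) ^ 3)"
    proof -
      have "\<beta> ^ 49 = \<beta> * (\<beta> ^ 24)\<^sup>2" by (simp flip: power_mult power_Suc)
      then show ?thesis by (simp add: power_mult_distrib)
    qed
    also have "\<dots> \<le> \<beta> ^ 49 / 32 * \<beta>" using \<beta> big by (intro mult_left_mono) auto
    also have "\<dots> = (\<beta> ^ 10 / 2) ^ 5"
    proof -
      have "\<beta> ^ 49 * \<beta> = (\<beta> ^ 10) ^ 5" by (simp flip: power_mult power_Suc2)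
      then show ?thesis by (simp add: power_divide)
    qed
    also have "\<dots> \<le> x3 ^ 5" using vals \<beta> by (intro power_mono) auto
    finally have "log \<beta> (\<beta> * (x1 ^ 2 * x32 ^ 3)) \<le> log \<beta> (x3 ^ 5)"
      using \<beta> xpos by (intro log_mono) auto
    then show ?thesis
      using \<beta> xpos unfolding L_def x1_def[symmetric] x3_def[symmetric] x32_def[symmetric] \<beta>_def[symmetric]
      by (simp add: log_mult log_nat_power)
  qed
  have "1 + (2 * y (part_ones d) + 3 * y (part_three_two d)) \<le> 5 * y (part_three d)"
  proof (rule LIMSEQ_le)
    show "(\<lambda>m. 1 + (2 * L (r m) (part_ones d) + 3 * L (r m) (part_three_two d))) \<longlonglongrightarrow>
        1 + (2 * y (part_ones d) + 3 * y (part_three_two d))"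
      by (intro tendsto_intros y parts)
    show "(\<lambda>m. 5 * L (r m) (part_three d)) \<longlonglongrightarrow> 5 * y (part_three d)"
      by (intro tendsto_intros y parts)
  qed (use key in blast)
  moreover have "restrict y ?I \<in> trop ?I (dual_cone ?I (BSigma (2 * d)))"
  proof -
    \<comment> \<open>The known null sequence is \<open>inverse (real (Suc m))\<close>, hence the
      shift by \<open>N - 1\<close>.\<close>
    have "(\<lambda>m. inverse (real (b m))) \<longlonglongrightarrow> 0"
      unfolding b_def using LIMSEQ_ignore_initial_segment[OF LIMSEQ_inverse_real_of_nat, of "N - 1"] bN(3)[of 0]
      by (simp add: b_def)
    from LIMSEQ_subseq_LIMSEQ[OF this r] have lim0: "(\<lambda>m. 1 / real (b (r m))) \<longlonglongrightarrow> 0"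
      by (simp add: o_def inverse_eq_divide)
    have dual: "restrict (X (b m)) ?I \<in> dual_cone ?I (BSigma (2 * d))" for m
      using B[OF bN(1)] by (simp add: dual_cone_def)
    have \<tau>: "0 < 1 / real (b (r m)) \<and> 1 / real (b (r m)) < 1" for m
      using b1[of "r m"] by simp
    show ?thesis
      unfolding trop_def
    proof (intro CollectI conjI exI[of _ "\<lambda>m. restrict (X (b (r m))) ?I"] exI[of _ "\<lambda>m. 1 / real (b (r m))"])
      show "\<forall>l \<in> ?I. (\<lambda>m. log (1 / (1 / real (b (r m)))) (restrict (X (b (r m))) ?I l)) \<longlonglongrightarrow> restrict y ?I l"
        using y by (simp add: L_def)
    qed (use lim0 dual pos \<tau> in auto)
  qed
  ultimately show ?thesis using parts by (intro bexI[of _ "restrict y ?I"]) auto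
qed

theorem theorem5p21:
  fixes d :: nat
  assumes "d \<ge> 5"
  shows "trop (even_partitions (2 * d)) (dual_cone (even_partitions (2 * d)) (BP (2 * d)))
       \<subset> trop (even_partitions (2 * d)) (dual_cone (even_partitions (2 * d)) (BSigma (2 * d)))"
proof -
  let ?I = "even_partitions (2 * d)"
  have "trop ?I (dual_cone ?I (BP (2 * d))) \<subseteq> trop ?I (dual_cone ?I (BSigma (2 * d)))"
    by (intro trop_mono dual_cone_antimono BSigma_subset_BP)
  then show ?thesis
    using trop_dual_BSigma_witness[OF assms] trop_dual_BP_inequality[OF assms] by fastforce
qed

end
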